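(* The metric $g_\infty$ has nonnegative generalized scalar curvature on the interior $\mathring M_\infty=M_\infty\setminus(\{a_\infty\}\times\mathbb S^2\cup\{b_\infty\}\times\mathbb S^2)$ of $M_\infty$, in the sense that, with $h_\infty=f_\infty^{3/2}$, $$h_\infty''\le\tfrac34\,h_\infty^{-1/3}$$ as distributions on $\mathring M_\infty$; i.e. for every $\tilde v\in C_c^\infty(\mathring M_\infty)$ with $\tilde v\ge0$, $$\int_{\mathring M_\infty} h_\infty(s)\,\partial_s^2\tilde v(s,\theta)\,ds\,d\mathrm{vol}_{\mathbb S^2}\le\int_{\mathring M_\infty}\tfrac34\,h_\infty(s)^{-1/3}\,\tilde v(s,\theta)\,ds\,d\mathrm{vol}_{\mathbb S^2}.$$
   Context: Let $D,A>0$. For $j\in\mathbb N$, $M_j$ is diffeomorphic to $\mathbb S^3$ with a smooth rotationally symmetric metric $g_j=ds^2+f_j(s)^2g_{\mathbb S^2}$, $0\le s\le D_j$, where $g_{\mathbb S^2}$ is the round unit-sphere metric and $f_j$ is smooth on $[0,D_j]$ with $f_j(0)=f_j(D_j)=0$, $f_j>0$ on $(0,D_j)$, $f_j'(0)=1$, $f_j'(D_j)=-1$. Assume for all $j$ that $\operatorname{Diam}(M_j)\le D$ (so $D_j\le D$), $\operatorname{Scalar}_j\ge0$, and $\operatorname{MinA}(M_j)\ge A>0$, where $\operatorname{MinA}(M_j)$ is the infimum of areas of closed embedded minimal surfaces in $M_j$. Extend $f_j$ by $0$ to $[D_j,D]$. After passing to a subsequence, $f_j$ converges uniformly on $[0,D]$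 to a function $f_\infty$ which is Lipschitz with constant $1$. Set $a_\infty=\sup\{s: f_\infty=0\text{ on }[0,s]\}$ and $b_\infty=\inf\{s: f_\infty=0\text{ on }[s,D]\}$; then $\{f_\infty>0\}=(a_\infty,b_\infty)$. The limit space is $M_\infty=[a_\infty,b_\infty]\times\mathbb S^2$ (end slices collapsed to points) with continuous metric tensor $g_\infty=ds^2+f_\infty(s)^2g_{\mathbb S^2}$, and $\mathring M_\infty=(a_\infty,b_\infty)\times\mathbb S^2$. For a smooth warping function $f>0$, nonnegative scalar curvature of $ds^2+f^2g_{\mathbb S^2}$ is equivalent to $h''\le\frac34h^{-1/3}$ for $h=f^{3/2}$. *)

theory Defs
  imports "HOL-Analysis.Analysis"
begin

section \<open>Smooth maps and local parametrizations of submanifolds of Euclidean space\<close>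

primrec Ck_on :: "nat \<Rightarrow> ('a::euclidean_space \<Rightarrow> 'b::real_normed_vector) \<Rightarrow> 'a set \<Rightarrow> bool" where
  "Ck_on 0 f U \<longleftrightarrow> continuous_on U f"
| "Ck_on (Suc k) f U \<longleftrightarrow>
     (\<forall>x\<in>U. f differentiable (at x)) \<and> (\<forall>v. Ck_on k (\<lambda>x. frechet_derivative f (at x) v) U)"

text \<open>Smoothness on an arbitrary subset of Euclidean space: near each point of the set the map
  is the restriction of a \<open>C\<^sup>\<infinity>\<close> map on an open set.  For open \<open>S\<close> this is ordinary
  \<open>C\<^sup>\<infinity>\<close>; for a closed interval it is smoothness up to the end points; for an embedded
  submanifold it is smoothness with respect to its manifold structure.\<close>

definition smooth_on :: "'a::euclidean_space set \<Rightarrow> ('a \<Rightarrow> 'b::real_normed_vector) \<Rightarrow> bool" where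
  "smooth_on S f \<longleftrightarrow>
     (\<forall>p\<in>S. \<exists>U F. open U \<and> p \<in> U \<and> (\<forall>k. Ck_on k F U) \<and> (\<forall>x\<in>U \<inter> S. F x = f x))"

definition local_param ::
  "'a::euclidean_space set \<Rightarrow> (real^'n) set \<Rightarrow> (real^'n \<Rightarrow> 'a) \<Rightarrow> bool" where
  "local_param M W \<psi> \<longleftrightarrow>
     open W \<and> smooth_on W \<psi> \<and> (\<forall>x\<in>W. inj (frechet_derivative \<psi> (at x))) \<and>
     openin (top_of_set M) (\<psi> ` W) \<and> (\<exists>\<rho>. homeomorphism W (\<psi> ` W) \<psi> \<rho>)"

definition pd :: "'n::finite \<Rightarrow> (real^'n \<Rightarrow> 'b::real_normed_vector) \<Rightarrow> real^'n \<Rightarrow> 'b" where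
  "pd i F x = frechet_derivative F (at x) (axis i 1)"


section \<open>Riemannian metrics\<close>

text \<open>A metric on \<open>M\<close> is a function \<open>g\<close>, where \<open>g p u v\<close> is the inner product of
  \<open>u, v \<in> T\<^sub>p M\<close>; its values on vectors not tangent to \<open>M\<close> are irrelevant.\<close>

type_synonym 'a metric = "'a \<Rightarrow> 'a \<Rightarrow> 'a \<Rightarrow> real"

definition coord_metric ::
  "'a::euclidean_space metric \<Rightarrow> (real^'n \<Rightarrow> 'a) \<Rightarrow> real^'n \<Rightarrow> real^'n^'n" where
  "coord_metric g \<psi> x = (\<chi> i j. g (\<psi> x) (pd i \<psi> x) (pd j \<psi> x))"

definition riemannian_metric3 :: "'a::euclidean_space set \<Rightarrow> 'a metric \<Rightarrow> bool" where
  "riemannian_metric3 M g \<longleftrightarrow>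
     (\<forall>(W :: (real^3) set) \<psi>. local_param M W \<psi> \<longrightarrow>
        smooth_on W (coord_metric g \<psi>) \<and>
        (\<forall>x\<in>W. let d = frechet_derivative \<psi> (at x) in
            bilinear (\<lambda>u v. g (\<psi> x) (d u) (d v)) \<and>
            (\<forall>u v. g (\<psi> x) (d u) (d v) = g (\<psi> x) (d v) (d u)) \<and>
            (\<forall>u. u \<noteq> 0 \<longrightarrow> g (\<psi> x) (d u) (d u) > 0)))"


section \<open>Curvature in coordinates\<close>

text \<open>\<open>christoffel G k i j\<close> is \<open>\<Gamma>\<^sup>k\<^bsub>ij\<^esub>\<close> of the Levi-Civita connection of \<open>G\<close>.\<close>

definition christoffel ::
  "(real^'n \<Rightarrow> real^'n^'n) \<Rightarrow> 'n::finite \<Rightarrow> 'n \<Rightarrow> 'n \<Rightarrow> real^'n \<Rightarrow> real" where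
  "christoffel G k i j x =
     (1/2) * (\<Sum>l\<in>UNIV. matrix_inv (G x) $ k $ l *
        (pd i (\<lambda>y. G y $ j $ l) x + pd j (\<lambda>y. G y $ i $ l) x - pd l (\<lambda>y. G y $ i $ j) x))"

definition ricci ::
  "(real^'n \<Rightarrow> real^'n^'n) \<Rightarrow> 'n::finite \<Rightarrow> 'n \<Rightarrow> real^'n \<Rightarrow> real" where
  "ricci G i j x =
     (\<Sum>k\<in>UNIV. pd k (christoffel G k i j) x - pd j (christoffel G k i k) x) +
     (\<Sum>k\<in>UNIV. \<Sum>l\<in>UNIV.
        christoffel G k k l x * christoffel G l i j x - christoffel G k j l x * christoffel G l i k x)"

definition scalar_curv :: "(real^'n \<Rightarrow> real^'n^'n) \<Rightarrow> real^'n::finite \<Rightarrow> real" where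
  "scalar_curv G x = (\<Sum>i\<in>UNIV. \<Sum>j\<in>UNIV. matrix_inv (G x) $ i $ j * ricci G i j x)"

definition nonneg_scalar3 :: "'a::euclidean_space set \<Rightarrow> 'a metric \<Rightarrow> bool" where
  "nonneg_scalar3 M g \<longleftrightarrow>
     (\<forall>(W :: (real^3) set) \<psi>. local_param M W \<psi> \<longrightarrow> (\<forall>x\<in>W. scalar_curv (coord_metric g \<psi>) x \<ge> 0))"


section \<open>Diameter\<close>

definition path_length :: "'a::euclidean_space metric \<Rightarrow> (real \<Rightarrow> 'a) \<Rightarrow> ennreal" where
  "path_length g \<gamma> =
     (\<integral>\<^sup>+t\<in>{0..1}. ennreal (sqrt (g (\<gamma> t) (vector_derivative \<gamma> (at t)) (vector_derivative \<gamma> (at t))))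
        \<partial>lborel)"

definition riem_dist :: "'a::euclidean_space set \<Rightarrow> 'a metric \<Rightarrow> 'a \<Rightarrow> 'a \<Rightarrow> ennreal" where
  "riem_dist M g p q =
     Inf (path_length g ` {\<gamma>. valid_path \<gamma> \<and> path_image \<gamma> \<subseteq> M \<and> pathstart \<gamma> = p \<and> pathfinish \<gamma> = q})"

definition riem_diam :: "'a::euclidean_space set \<Rightarrow> 'a metric \<Rightarrow> ennreal" where
  "riem_diam M g = (SUP p\<in>M. SUP q\<in>M. riem_dist M g p q)"


section \<open>Minimal surfaces and MinA\<close>

definition closed_embedded_surface :: "'a::euclidean_space set \<Rightarrow> 'a set \<Rightarrow> bool" where
  "closed_embedded_surface M \<Sigma> \<longleftrightarrow>
     \<Sigma> \<noteq> {} \<and> compact \<Sigma> \<and> \<Sigma> \<subseteq> M \<and>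
     (\<forall>p\<in>\<Sigma>. \<exists>(V :: (real^2) set) \<phi>. local_param \<Sigma> V \<phi> \<and> p \<in> \<phi> ` V)"

text \<open>For a surface \<open>\<phi>\<close> in a coordinate domain with metric \<open>G\<close>: the induced metric,
  the covariant derivative \<open>\<nabla>\<^sub>a \<partial>\<^sub>b \<phi>\<close>, and the mean curvature (trace of the second
  fundamental form) with respect to a normal vector \<open>\<nu>\<close>.\<close>

definition first_fundamental ::
  "(real^'n \<Rightarrow> real^'n^'n) \<Rightarrow> (real^2 \<Rightarrow> real^'n) \<Rightarrow> real^2 \<Rightarrow> real^2^2" where
  "first_fundamental G \<phi> x = (\<chi> a b. pd a \<phi> x \<bullet> (G (\<phi> x) *v pd b \<phi> x))"

definition cov_second_deriv ::
  "(real^'n \<Rightarrow> real^'n^'n) \<Rightarrow> (real^2 \<Rightarrow> real^'n::finite) \<Rightarrow> 2 \<Rightarrow> 2 \<Rightarrow> real^2 \<Rightarrow> real^'n" where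
  "cov_second_deriv G \<phi> a b x =
     (\<chi> k. pd a (pd b \<phi>) x $ k +
        (\<Sum>i\<in>UNIV. \<Sum>j\<in>UNIV. christoffel G k i j (\<phi> x) * pd a \<phi> x $ i * pd b \<phi> x $ j))"

definition mean_curvature ::
  "(real^'n \<Rightarrow> real^'n^'n) \<Rightarrow> (real^2 \<Rightarrow> real^'n::finite) \<Rightarrow> real^'n \<Rightarrow> real^2 \<Rightarrow> real" where
  "mean_curvature G \<phi> \<nu> x =
     (\<Sum>a\<in>UNIV. \<Sum>b\<in>UNIV. matrix_inv (first_fundamental G \<phi> x) $ a $ b *
        (cov_second_deriv G \<phi> a b x \<bullet> (G (\<phi> x) *v \<nu>)))"

definition unit_normal ::
  "(real^'n \<Rightarrow> real^'n^'n) \<Rightarrow> (real^2 \<Rightarrow> real^'n::finite) \<Rightarrow> real^'n \<Rightarrow> real^2 \<Rightarrow> bool" where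
  "unit_normal G \<phi> \<nu> x \<longleftrightarrow>
     \<nu> \<bullet> (G (\<phi> x) *v \<nu>) = 1 \<and> (\<forall>a. pd a \<phi> x \<bullet> (G (\<phi> x) *v \<nu>) = 0)"

text \<open>Here \<open>\<psi>\<close> parametrizes the 3-manifold and \<open>\<psi> \<circ> \<phi>\<close> the surface, both near \<open>p\<close>.
  Whether the mean curvature vanishes at \<open>p\<close> does not depend on the choice of \<open>\<psi>, \<phi>\<close>.\<close>

definition closed_minimal_surface :: "'a::euclidean_space set \<Rightarrow> 'a metric \<Rightarrow> 'a set \<Rightarrow> bool" where
  "closed_minimal_surface M g \<Sigma> \<longleftrightarrow>
     closed_embedded_surface M \<Sigma> \<and>
     (\<forall>p\<in>\<Sigma>. \<exists>(W :: (real^3) set) \<psi> (V :: (real^2) set) \<phi>. \<exists>x\<in>V.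
        local_param M W \<psi> \<and> \<phi> ` V \<subseteq> W \<and> smooth_on V \<phi> \<and> local_param \<Sigma> V (\<psi> \<circ> \<phi>) \<and> \<psi> (\<phi> x) = p \<and>
        (\<forall>\<nu>. unit_normal (coord_metric g \<psi>) \<phi> \<nu> x \<longrightarrow>
              mean_curvature (coord_metric g \<psi>) \<phi> \<nu> x = 0))"

text \<open>Area of a closed embedded surface: cut it into finitely many disjoint Borel pieces, each
  inside one local parametrization, and add up the integrals of the area element.  Such a
  decomposition exists by compactness and the sum is the same for all decompositions, so the
  infimum only serves to select this common value.\<close>

definition surface_area :: "'a::euclidean_space metric \<Rightarrow> 'a set \<Rightarrow> ennreal" where
  "surface_area g \<Sigma> =
     Inf {(\<Sum>i<n. \<integral>\<^sup>+x\<in>B i. ennreal (sqrt (det (coord_metric g (\<phi> i) x))) \<partial>lborel)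
          | (n::nat) (V :: nat \<Rightarrow> (real^2) set) \<phi> B.
            (\<forall>i<n. local_param \<Sigma> (V i) (\<phi> i) \<and> B i \<in> sets borel \<and> B i \<subseteq> V i) \<and>
            disjoint_family_on (\<lambda>i. \<phi> i ` B i) {..<n} \<and> (\<Union>i<n. \<phi> i ` B i) = \<Sigma>}"

text \<open>As an infimum in \<open>ennreal\<close>, this is \<open>\<infinity>\<close> if there are no such surfaces.\<close>

definition MinA :: "'a::euclidean_space set \<Rightarrow> 'a metric \<Rightarrow> ennreal" where
  "MinA M g = Inf (surface_area g ` {\<Sigma>. closed_minimal_surface M g \<Sigma>})"


section \<open>Rotationally symmetric metrics on the 3-sphere\<close>

abbreviation S2 :: "(real^3) set" where "S2 \<equiv> sphere 0 1"
abbreviation S3 :: "(real \<times> (real^3)) set" where "S3 \<equiv> sphere 0 1"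

text \<open>Polar coordinates \<open>[0,L] \<times> S\<^sup>2 \<rightarrow> S\<^sup>3\<close>, where \<open>s\<close> is \<open>L/\<pi>\<close> times the round distance from
  the pole \<open>(1,0)\<close>; the slices \<open>s = 0\<close> and \<open>s = L\<close> are collapsed to the poles.\<close>

definition polar :: "real \<Rightarrow> real \<times> (real^3) \<Rightarrow> real \<times> (real^3)" where
  "polar L = (\<lambda>(s, w). (cos (pi * s / L), sin (pi * s / L) *\<^sub>R w))"

text \<open>\<open>g\<close> is a smooth metric on \<open>S\<^sup>3\<close> which in polar coordinates is
  \<open>ds\<^sup>2 + f(s)\<^sup>2 g\<^bsub>S\<^sup>2\<^esub>\<close>.  Below, \<open>(c, u)\<close> and \<open>(d, v)\<close> run through the tangent vectors of
  \<open>(0,L) \<times> S\<^sup>2\<close> at \<open>(s, w)\<close>; at the poles \<open>g\<close> is determined by continuity.\<close>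

definition rot_symmetric_sphere ::
  "real \<Rightarrow> (real \<Rightarrow> real) \<Rightarrow> (real \<times> (real^3)) metric \<Rightarrow> bool" where
  "rot_symmetric_sphere L f g \<longleftrightarrow>
     L > 0 \<and> smooth_on {0..L} f \<and> f 0 = 0 \<and> f L = 0 \<and> (\<forall>s\<in>{0<..<L}. f s > 0) \<and>
     (f has_real_derivative 1) (at 0 within {0..L}) \<and>
     (f has_real_derivative -1) (at L within {0..L}) \<and>
     riemannian_metric3 S3 g \<and>
     (\<forall>s\<in>{0<..<L}. \<forall>w\<in>S2. \<forall>c d u v. u \<bullet> w = 0 \<and> v \<bullet> w = 0 \<longrightarrow>
        g (polar L (s, w))
          (frechet_derivative (polar L) (at (s, w)) (c, u))
          (frechet_derivative (polar L) (at (s, w)) (d, v))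
        = c * d + (f s)\<^sup>2 * (u \<bullet> v))"

definition extend_zero :: "real \<Rightarrow> (real \<Rightarrow> real) \<Rightarrow> real \<Rightarrow> real" where
  "extend_zero L f s = (if s \<in> {0..L} then f s else 0)"


section \<open>The limit space\<close>

definition a_end :: "real \<Rightarrow> (real \<Rightarrow> real) \<Rightarrow> real" where
  "a_end D f = Sup {s\<in>{0..D}. \<forall>t\<in>{0..s}. f t = 0}"

definition b_end :: "real \<Rightarrow> (real \<Rightarrow> real) \<Rightarrow> real" where
  "b_end D f = Inf {s\<in>{0..D}. \<forall>t\<in>{s..D}. f t = 0}"

definition interior_limit :: "real \<Rightarrow> (real \<Rightarrow> real) \<Rightarrow> (real \<times> (real^3)) set" where
  "interior_limit D f = {a_end D f<..<b_end D f} \<times> S2"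

text \<open>The area measure \<open>sin \<alpha> d\<alpha> d\<beta>\<close> of the unit sphere in spherical coordinates.\<close>

definition sphere_vol :: "(real^3) measure" where
  "sphere_vol =
     distr (density (lborel :: (real \<times> real) measure)
              (\<lambda>(\<alpha>, \<beta>). ennreal (sin \<alpha>) * indicator ({0..pi} \<times> {0..2 * pi}) (\<alpha>, \<beta>)))
       borel (\<lambda>(\<alpha>, \<beta>). vector [sin \<alpha> * cos \<beta>, sin \<alpha> * sin \<beta>, cos \<alpha>])"

definition test_function :: "(real \<times> (real^3)) set \<Rightarrow> (real \<times> (real^3) \<Rightarrow> real) \<Rightarrow> bool" where
  "test_function M v \<longleftrightarrow>
     smooth_on M v \<and> (\<exists>K. compact K \<and> K \<subseteq> M \<and> (\<forall>z\<in>M - K. v z = 0))"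

definition pd_ss :: "(real \<times> (real^3) \<Rightarrow> real) \<Rightarrow> real \<times> (real^3) \<Rightarrow> real" where
  "pd_ss v = (\<lambda>(s, w). deriv (deriv (\<lambda>t. v (t, w))) s)"

text \<open>\<open>h'' \<le> (3/4) h\<^bsup>-1/3\<^esup>\<close> as distributions on \<open>M\<close>, for a function \<open>h\<close> of \<open>s\<close>.  Since the
  Lebesgue integral of a non-integrable function is 0 by convention, integrability of both
  sides is made explicit.\<close>

definition nonneg_generalized_scalar ::
  "(real \<times> (real^3)) set \<Rightarrow> (real \<Rightarrow> real) \<Rightarrow> bool" where
  "nonneg_generalized_scalar M h \<longleftrightarrow>
     (\<forall>v. test_function M v \<and> (\<forall>z\<in>M. v z \<ge> 0) \<longrightarrow>
        set_integrable (lborel \<Otimes>\<^sub>M sphere_vol) M (\<lambda>z. h (fst z) * pd_ss v z) \<and>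
        set_integrable (lborel \<Otimes>\<^sub>M sphere_vol) M (\<lambda>z. 3/4 * h (fst z) powr (-1/3) * v z) \<and>
        (LINT z:M|(lborel \<Otimes>\<^sub>M sphere_vol). h (fst z) * pd_ss v z)
          \<le> (LINT z:M|(lborel \<Otimes>\<^sub>M sphere_vol). 3/4 * h (fst z) powr (-1/3) * v z))"

end

theory Submission
  imports Defs
begin

text \<open>
  The scalar curvature of \<open>ds\<^sup>2 + f(s)\<^sup>2 g\<^bsub>S\<^sup>2\<^esub>\<close> is \<open>2 (1 - f'\<^sup>2) / f\<^sup>2 - 4 f'' / f\<close>, so it is
  nonnegative exactly when \<open>2 f f'' \<le> 1 - f'\<^sup>2\<close>.  For \<open>h = f\<^bsup>3/2\<^esup>\<close> one has
  \<open>h'' = (3/4) f\<^bsup>-1/2\<^esup> (f'\<^sup>2 + 2 f f'')\<close>, and the curvature condition becomes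
  \<open>h'' \<le> (3/4) f\<^bsup>-1/2\<^esup> = (3/4) h\<^bsup>-1/3\<^esup>\<close>.  Tested against a nonnegative function of compact support
  and integrated by parts, this involves no derivative of \<open>h\<close>.  It therefore survives uniform
  convergence of \<open>f\<close>, provided that \<open>f\<close> stays away from \<open>0\<close> on the support, so that the singular
  factor \<open>h\<^bsup>-1/3\<^esup>\<close> converges as well (\<open>weak_inequality_limit\<close>).

  The main work is to show that the limit is positive strictly between its two ends, and this
  is where the area bound enters.  If the limit vanished at an interior point with positive values on
  both sides, then for large \<open>j\<close> the function \<open>f\<^sub>j\<close> would have an interior local minimum with an
  arbitrarily small value.  The slice over a critical point \<open>s\<close> of \<open>f\<^sub>j\<close> is a closed minimal surface
  (\<open>closed_minimal_slice\<close>), and its area is at most a universal constant times \<open>f\<^sub>j(s)\<^sup>2\<close>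
  (\<open>slice_area_bound\<close>), which contradicts the lower bound on the area of minimal surfaces
  (\<open>neck_radius_bound\<close>, \<open>limit_interior\<close>).  The diameter bound enters through
  \<open>diameter_ge_pole_distance\<close>: a curve between the poles is at least as long as the interval on
  which \<open>f\<^sub>j\<close> lives.  Hence all these intervals lie in \<open>[0,D]\<close>, the limit vanishes at both ends of
  \<open>[0,D]\<close>, and the two end points of the limit space are meaningful.

  The metrics are given on the sphere in \<open>\<real> \<times> \<real>\<^sup>3\<close> and are tested through arbitrary local
  parametrizations.  A single family of charts is used: arc length from the pole together with latitude and
  longitude, composed with a rotation of \<open>\<real>\<^sup>3\<close>.  In each of them the metric is the diagonal matrix with entries
  \<open>1, f\<^sup>2, f\<^sup>2 cos\<^sup>2\<close> (\<open>coord_metric_chart\<close>), from which curvature, minimality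
  and area are computed by hand.  Finally, the inequality along each meridian is integrated over the
  sphere of directions (\<open>distributional_inequality_from_meridians\<close>).
\<close>

section \<open>Calculus of \<open>C\<^sup>k\<close> maps\<close>

text \<open>
  Since derivatives on an open set only see nearby values, functions that agree there may be
  exchanged.  This allows derivatives to be replaced by explicit formulas known only on the set.
\<close>

lemma Ck_on_cong:
  assumes "open U" "\<And>x. x \<in> U \<Longrightarrow> f x = g x"
  shows "Ck_on k f U \<longleftrightarrow> Ck_on k g U"
  using assms(2)
proof (induction k arbitrary: f g)
  case 0
  then show ?case by (auto cong: continuous_on_cong)
next
  case (Suc k)
  have d: "(f has_derivative D) (at x) \<longleftrightarrow> (g has_derivative D) (at x)" if "x \<in> U" for x D
    using Suc.prems assms(1) that
    by (metis has_derivative_transform_within_open)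
  have "f differentiable at x \<longleftrightarrow> g differentiable at x" if "x \<in> U" for x
    using d[OF that] by (simp add: differentiable_def)
  moreover have "frechet_derivative f (at x) = frechet_derivative g (at x)" if "x \<in> U" for x
    using d[OF that] by (simp add: frechet_derivative_def)
  ultimately show ?case
    using Suc.IH[of "\<lambda>x. frechet_derivative f (at x) v" "\<lambda>x. frechet_derivative g (at x) v" for v] by auto
qed

lemma Ck_on_SucI:
  assumes "open U" "\<And>x. x \<in> U \<Longrightarrow> (f has_derivative f' x) (at x)"
    and "\<And>v. Ck_on k (\<lambda>x. f' x v) U"
  shows "Ck_on (Suc k) f U"
proof -
  have "Ck_on k (\<lambda>x. frechet_derivative f (at x) v) U" for v
    using Ck_on_cong[OF assms(1), of "\<lambda>x. frechet_derivative f (at x) v" "\<lambda>x. f' x v"] assms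
    by (metis frechet_derivative_at)
  then show ?thesis using assms(2) by (auto simp: differentiable_def)
qed

lemma Ck_on_SucD: "Ck_on (Suc k) f U \<Longrightarrow> Ck_on k f U"
  by (induction k arbitrary: f)
    (auto intro!: continuous_at_imp_continuous_on differentiable_imp_continuous_within)

lemma Ck_on_has_derivative:
  "Ck_on (Suc k) f U \<Longrightarrow> x \<in> U \<Longrightarrow> (f has_derivative frechet_derivative f (at x)) (at x)"
  by (simp add: frechet_derivative_works[symmetric])

lemma Ck_on_const: "Ck_on k (\<lambda>x. c) U"
  by (induction k arbitrary: c) (auto simp: frechet_derivative_const)

lemma Ck_on_bounded_linear:
  assumes "bounded_linear T" "open U"
  shows "Ck_on k T U"
proof (cases k)
  case 0 then show ?thesis using assms by (simp add: linear_continuous_on)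
next
  case (Suc m)
  show ?thesis unfolding Suc
    by (rule Ck_on_SucI[OF assms(2), where f' = "\<lambda>_. T"])
       (auto simp: assms(1) bounded_linear_imp_has_derivative Ck_on_const)
qed

lemma Ck_on_add:
  assumes "open U" "Ck_on k f U" "Ck_on k g U"
  shows "Ck_on k (\<lambda>x. f x + g x) U"
  using assms(2,3)
proof (induction k arbitrary: f g)
  case 0 then show ?case by (auto intro: continuous_on_add)
next
  case (Suc k)
  show ?case
    by (rule Ck_on_SucI[OF assms(1) has_derivative_add[OF Ck_on_has_derivative[OF Suc.prems(1)] Ck_on_has_derivative[OF Suc.prems(2)]]])
       (use Suc in auto)
qed

lemma Ck_on_scaleR:
  fixes f :: "'a::euclidean_space \<Rightarrow> real" and g :: "'a \<Rightarrow> 'b::real_normed_vector"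
  assumes "open U" "Ck_on k f U" "Ck_on k g U"
  shows "Ck_on k (\<lambda>x. f x *\<^sub>R g x) U"
  using assms(2,3)
proof (induction k arbitrary: f g)
  case 0 then show ?case by (auto intro: continuous_on_scaleR)
next
  case (Suc k)
  show ?case
    by (rule Ck_on_SucI[OF assms(1) has_derivative_scaleR[OF Ck_on_has_derivative[OF Suc.prems(1)] Ck_on_has_derivative[OF Suc.prems(2)]]], assumption, assumption)
       (rule Ck_on_add[OF assms(1) Suc.IH Suc.IH], use Suc.prems Ck_on_SucD in \<open>simp_all add: Ck_on_SucD[OF Suc.prems(1)] Ck_on_SucD[OF Suc.prems(2)]\<close>)
qed

lemma Ck_on_mult:
  fixes f g :: "'a::euclidean_space \<Rightarrow> real"
  assumes "open U" "Ck_on k f U" "Ck_on k g U"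
  shows "Ck_on k (\<lambda>x. f x * g x) U"
  using Ck_on_scaleR[OF assms] by simp

text \<open>
  The two claims are proved together because differentiation exchanges sine and cosine.  With sums and
  products this covers all the parametrizations used below.
\<close>

lemma Ck_on_sin_cos:
  fixes f :: "'a::euclidean_space \<Rightarrow> real"
  assumes "open U" "Ck_on k f U"
  shows "Ck_on k (\<lambda>x. sin (f x)) U \<and> Ck_on k (\<lambda>x. cos (f x)) U"
  using assms(2)
proof (induction k)
  case 0 then show ?case by (auto intro: continuous_intros)
next
  case (Suc k)
  note IH = Suc.IH[OF Ck_on_SucD[OF Suc.prems]]
  have f': "Ck_on k (\<lambda>x. frechet_derivative f (at x) v) U" for v
    using Suc.prems by simp
  have "Ck_on (Suc k) (\<lambda>x. sin (f x)) U"
  proof (rule Ck_on_SucI[OF assms(1)])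
    show "((\<lambda>x. sin (f x)) has_derivative (\<lambda>v. frechet_derivative f (at x) v * cos (f x))) (at x)" if "x \<in> U" for x
      using Ck_on_has_derivative[OF Suc.prems that] by (auto intro!: derivative_eq_intros simp: mult.commute)
    show "Ck_on k (\<lambda>x. frechet_derivative f (at x) v * cos (f x)) U" for v
      by (intro Ck_on_mult assms f' IH[THEN conjunct2])
  qed
  moreover have "Ck_on (Suc k) (\<lambda>x. cos (f x)) U"
  proof (rule Ck_on_SucI[OF assms(1)])
    show "((\<lambda>x. cos (f x)) has_derivative (\<lambda>v. (-1) * (frechet_derivative f (at x) v * sin (f x)))) (at x)" if "x \<in> U" for x
      using Ck_on_has_derivative[OF Suc.prems that] by (auto intro!: derivative_eq_intros simp: mult.commute)
    show "Ck_on k (\<lambda>x. (-1) * (frechet_derivative f (at x) v * sin (f x))) U" for v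
      by (intro Ck_on_mult Ck_on_const assms f' IH[THEN conjunct1])
  qed
  ultimately show ?case by simp
qed

lemma Ck_on_imp_smooth_on:
  assumes "open U" "\<And>k. Ck_on k f U" "S \<subseteq> U"
  shows "smooth_on S f"
  unfolding smooth_on_def using assms by blast

lemma Ck_on_subset: "Ck_on k f U \<Longrightarrow> V \<subseteq> U \<Longrightarrow> Ck_on k f V"
  by (induction k arbitrary: f) (auto intro: continuous_on_subset)

lemma Ck_on_deriv:
  fixes f :: "real \<Rightarrow> real"
  assumes "open U" "Ck_on (Suc k) f U"
  shows "x \<in> U \<Longrightarrow> (f has_real_derivative deriv f x) (at x)" "Ck_on k (deriv f) U"
proof -
  have d: "(f has_real_derivative deriv f x) (at x)" if "x \<in> U" for x
    using assms(2) that by (simp add: DERIV_deriv_iff_real_differentiable)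
  then show "x \<in> U \<Longrightarrow> (f has_real_derivative deriv f x) (at x)" .
  have "frechet_derivative f (at x) 1 = deriv f x" if "x \<in> U" for x
    using frechet_derivative_at[OF d[OF that, unfolded has_field_derivative_def], symmetric] by simp
  moreover have "Ck_on k (\<lambda>x. frechet_derivative f (at x) 1) U" using assms(2) by simp
  ultimately show "Ck_on k (deriv f) U"
    using Ck_on_cong[OF assms(1), of "\<lambda>x. frechet_derivative f (at x) 1" "deriv f" k] by blast
qed

text \<open>
  Smoothness on a set is phrased with local extensions; near an interior point the extension
  coincides with the function, which can then be differentiated directly.
\<close>

lemma smooth_on_interior:
  assumes "smooth_on S f" "open V" "V \<subseteq> S" "x \<in> V"
  obtains U where "open U" "x \<in> U" "U \<subseteq> V" "\<And>k. Ck_on k f U"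
proof -
  from bspec[OF assms(1)[unfolded smooth_on_def] subsetD[OF assms(3,4)]]
  obtain U F where U: "open U" "x \<in> U" "\<forall>k. Ck_on k F U" "\<forall>y\<in>U \<inter> S. F y = f y"
    by (elim exE conjE)
  have "Ck_on k f (U \<inter> V)" for k
  proof -
    have "Ck_on k F (U \<inter> V)" by (rule Ck_on_subset[OF spec[OF U(3)]]) simp
    moreover have "Ck_on k F (U \<inter> V) \<longleftrightarrow> Ck_on k f (U \<inter> V)"
      by (rule Ck_on_cong) (use U(1,4) assms(2,3) in auto)
    ultimately show ?thesis by simp
  qed
  then show thesis using U(1,2) assms(2,4) by (intro that[of "U \<inter> V"]) auto
qed

lemma continuous_on_locally_agree:
  fixes f :: "'a::euclidean_space \<Rightarrow> 'b::real_normed_vector"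
  assumes "\<And>x. x \<in> S \<Longrightarrow> \<exists>U F. open U \<and> x \<in> U \<and> continuous_on U F \<and> (\<forall>y\<in>U \<inter> S. F y = f y)"
  shows "continuous_on S f"
  unfolding continuous_on_eq_continuous_within
proof
  fix x assume x: "x \<in> S"
  from assms[OF this] obtain U F where U: "open U" "x \<in> U" "continuous_on U F" "\<forall>y\<in>U \<inter> S. F y = f y"
    by (elim exE conjE)
  have "(F \<longlongrightarrow> F x) (at x within S)"
    using U(1,2,3) by (metis continuous_on_eq_continuous_at continuous_at_imp_continuous_at_within continuous_within)
  moreover have "\<forall>\<^sub>F y in at x within S. F y = f y"
    using U by (auto simp: eventually_at_filter eventually_nhds intro!: exI[of _ U])
  ultimately have "(f \<longlongrightarrow> F x) (at x within S)" by (rule Lim_transform_eventually)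
  moreover have "F x = f x" using U(2,4) x by blast
  ultimately show "continuous (at x within S) f" by (simp only: continuous_within)
qed

lemma smooth_on_continuous:
  assumes "smooth_on S f"
  shows "continuous_on S f"
proof (rule continuous_on_locally_agree)
  fix x assume "x \<in> S"
  from bspec[OF assms[unfolded smooth_on_def] this]
  obtain U F where U: "open U" "x \<in> U" "\<forall>k. Ck_on k F U" "\<forall>y\<in>U \<inter> S. F y = f y"
    by (elim exE conjE)
  have "continuous_on U F" using spec[OF U(3), of 0] by simp
  with U(1,2,4) show "\<exists>U F. open U \<and> x \<in> U \<and> continuous_on U F \<and> (\<forall>y\<in>U \<inter> S. F y = f y)"
    by (intro exI[of _ U] exI[of _ F] conjI)
qed

section \<open>Polar charts of the sphere and of its slices\<close>

text \<open>Latitude \<open>\<alpha>\<close> and longitude \<open>\<beta>\<close> on the unit sphere, centred at the first basis vector.\<close>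

definition sph :: "real \<Rightarrow> real \<Rightarrow> real^3" where
  "sph \<alpha> \<beta> = vector [cos \<alpha> * cos \<beta>, cos \<alpha> * sin \<beta>, sin \<alpha>]"

text \<open>The differential of \<open>sph\<close> at \<open>(\<alpha>, \<beta>)\<close> applied to \<open>(a, b)\<close>.\<close>

definition dsph :: "real \<Rightarrow> real \<Rightarrow> real \<Rightarrow> real \<Rightarrow> real^3" where
  "dsph \<alpha> \<beta> a b = vector [- sin \<alpha> * cos \<beta> * a - cos \<alpha> * sin \<beta> * b,
     - sin \<alpha> * sin \<beta> * a + cos \<alpha> * cos \<beta> * b, cos \<alpha> * a]"

text \<open>
  The parameters are arc length from the pole, latitude and longitude.  The rotation \<open>R\<close> moves the centre of
  the chart of the sphere of directions to \<open>R (axis 1 1)\<close>, so that these charts cover everything but the two poles.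
\<close>

definition chart :: "real \<Rightarrow> (real^3 \<Rightarrow> real^3) \<Rightarrow> real^3 \<Rightarrow> real \<times> (real^3)" where
  "chart L R y = polar L (y$1, R (sph (y$2) (y$3)))"

definition chart_dom :: "real \<Rightarrow> (real^3) set" where
  "chart_dom L = {y. y$1 \<in> {0<..<L} \<and> y$2 \<in> {-(pi/2)<..<pi/2} \<and> y$3 \<in> {-(pi/2)<..<pi/2}}"

definition slice_emb :: "real \<Rightarrow> real^2 \<Rightarrow> real^3" where
  "slice_emb s x = vector [s, x$1, x$2]"

definition slice_dom :: "(real^2) set" where
  "slice_dom = {x. x$1 \<in> {-(pi/2)<..<pi/2} \<and> x$2 \<in> {-(pi/2)<..<pi/2}}"

lemma sph_alt: "sph \<alpha> \<beta> = (cos \<alpha> * cos \<beta>) *\<^sub>R axis 1 1 + ((cos \<alpha> * sin \<beta>) *\<^sub>R axis 2 1 + sin \<alpha> *\<^sub>R axis 3 1)"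
  by (simp add: sph_def vec_eq_iff forall_3 axis_def)

lemma dsph_alt: "dsph \<alpha> \<beta> a b = (- sin \<alpha> * cos \<beta> * a - cos \<alpha> * sin \<beta> * b) *\<^sub>R axis 1 1
    + ((- sin \<alpha> * sin \<beta> * a + cos \<alpha> * cos \<beta> * b) *\<^sub>R axis 2 1 + (cos \<alpha> * a) *\<^sub>R axis 3 1)"
  by (simp add: dsph_def vec_eq_iff forall_3 axis_def)

lemma has_derivative_sph:
  "((\<lambda>p. sph (p$i) (p$j)) has_derivative (\<lambda>u. dsph (x$i) (x$j) (u$i) (u$j))) (at x)"
  unfolding sph_alt dsph_alt
  by (auto intro!: derivative_eq_intros bounded_linear_imp_has_derivative[OF bounded_linear_vec_nth] ext
      simp: algebra_simps)

lemma inner_sph_sph: "sph \<alpha> \<beta> \<bullet> sph \<alpha> \<beta> = 1"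
proof -
  have "sph \<alpha> \<beta> \<bullet> sph \<alpha> \<beta> = (cos \<alpha>)\<^sup>2 * ((cos \<beta>)\<^sup>2 + (sin \<beta>)\<^sup>2) + (sin \<alpha>)\<^sup>2"
    by (simp only: sph_def inner_vec_def sum_3 vector_3 inner_real_def, algebra)
  then show ?thesis by simp
qed

lemma inner_dsph_sph: "dsph \<alpha> \<beta> a b \<bullet> sph \<alpha> \<beta> = 0"
proof -
  have "dsph \<alpha> \<beta> a b \<bullet> sph \<alpha> \<beta> = a * sin \<alpha> * cos \<alpha> * (1 - ((cos \<beta>)\<^sup>2 + (sin \<beta>)\<^sup>2))"
    by (simp only: dsph_def sph_def inner_vec_def sum_3 vector_3 inner_real_def, algebra)
  then show ?thesis by simp
qed

lemma inner_dsph_dsph: "dsph \<alpha> \<beta> a b \<bullet> dsph \<alpha> \<beta> c d = a * c + (cos \<alpha>)\<^sup>2 * b * d"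
proof -
  have "dsph \<alpha> \<beta> a b \<bullet> dsph \<alpha> \<beta> c d = a * c * ((sin \<alpha>)\<^sup>2 * ((cos \<beta>)\<^sup>2 + (sin \<beta>)\<^sup>2) + (cos \<alpha>)\<^sup>2)
      + (cos \<alpha>)\<^sup>2 * b * d * ((cos \<beta>)\<^sup>2 + (sin \<beta>)\<^sup>2)"
    by (simp only: dsph_def inner_vec_def sum_3 vector_3 inner_real_def, algebra)
  then show ?thesis by simp
qed

lemma has_derivative_polar:
  "(polar L has_derivative (\<lambda>(c, u). (- sin (pi * s / L) * (pi / L) * c,
      (cos (pi * s / L) * (pi / L) * c) *\<^sub>R w + sin (pi * s / L) *\<^sub>R u))) (at (s, w))"
proof -
  have "((\<lambda>p. (cos (pi * fst p / L), sin (pi * fst p / L) *\<^sub>R snd p)) has_derivative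
     (\<lambda>p. (- sin (pi * s / L) * (pi / L) * fst p,
      (cos (pi * s / L) * (pi / L) * fst p) *\<^sub>R w + sin (pi * s / L) *\<^sub>R snd p))) (at (s, w))"
    by (auto intro!: derivative_eq_intros ext simp: algebra_simps divide_inverse)
  then show ?thesis by (simp add: polar_def case_prod_unfold)
qed

lemmas frechet_derivative_polar = frechet_derivative_at[OF has_derivative_polar, symmetric]

lemma has_derivative_chart:
  assumes "linear R"
  shows "(chart L R has_derivative
     (\<lambda>u. frechet_derivative (polar L) (at (y$1, R (sph (y$2) (y$3)))) (u$1, R (dsph (y$2) (y$3) (u$2) (u$3))))) (at y)"
proof -
  have bl: "bounded_linear R" using assms linear_conv_bounded_linear by blast
  have "((\<lambda>y. (y$1, R (sph (y$2) (y$3)))) has_derivative (\<lambda>u. (u$1, R (dsph (y$2) (y$3) (u$2) (u$3))))) (at y)"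
    by (intro has_derivative_Pair bounded_linear.has_derivative[OF bl] has_derivative_sph
         bounded_linear_imp_has_derivative[OF bounded_linear_vec_nth])
  from diff_chain_at[OF this has_derivative_polar[of L "y$1" "R (sph (y$2) (y$3))"]]
  show ?thesis by (simp add: frechet_derivative_polar chart_def[abs_def] o_def)
qed

lemmas frechet_derivative_chart = frechet_derivative_at[OF has_derivative_chart, symmetric]

lemma smooth_chart:
  assumes "linear R"
  shows "Ck_on k (chart L R) UNIV"
proof -
  have e: "chart L R = (\<lambda>y. cos (pi / L * y$1) *\<^sub>R (1, 0) +
     ((sin (pi / L * y$1) * (cos (y$2) * cos (y$3))) *\<^sub>R (0, R (axis 1 1)) +
     ((sin (pi / L * y$1) * (cos (y$2) * sin (y$3))) *\<^sub>R (0, R (axis 2 1)) +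
     (sin (pi / L * y$1) * (sin (y$2))) *\<^sub>R (0, R (axis 3 1)))))"
    by (rule ext)
     (simp add: chart_def polar_def sph_alt linear_add[OF assms] linear_scale[OF assms] prod_eq_iff scaleR_add_right mult.commute)
  have n: "Ck_on k (\<lambda>y::real^3. y $ i) UNIV" for i
    by (simp add: Ck_on_bounded_linear bounded_linear_vec_nth)
  show ?thesis unfolding e
    by (intro Ck_on_add Ck_on_scaleR Ck_on_mult Ck_on_const n Ck_on_sin_cos[THEN conjunct1] Ck_on_sin_cos[THEN conjunct2] open_UNIV)
qed

lemma has_derivative_slice_emb: "(slice_emb s has_derivative (\<lambda>u. vector [0, u$1, u$2])) (at x)"
proof -
  have e: "slice_emb s = (\<lambda>x. s *\<^sub>R axis 1 1 + (x$1 *\<^sub>R axis 2 1 + x$2 *\<^sub>R axis 3 1))"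
    "(\<lambda>u. vector [0, u$1, u$2] :: real^3) = (\<lambda>u::real^2. u$1 *\<^sub>R axis 2 1 + u$2 *\<^sub>R axis 3 1)"
    by (auto simp: fun_eq_iff slice_emb_def vec_eq_iff forall_3 axis_def)
  show ?thesis unfolding e
    by (auto intro!: derivative_eq_intros bounded_linear_imp_has_derivative[OF bounded_linear_vec_nth])
qed

lemmas frechet_derivative_slice_emb = frechet_derivative_at[OF has_derivative_slice_emb, symmetric]

lemma smooth_slice_emb: "Ck_on k (slice_emb s) UNIV"
proof -
  have e: "slice_emb s = (\<lambda>x. s *\<^sub>R axis 1 1 + (x$1 *\<^sub>R axis 2 1 + x$2 *\<^sub>R axis 3 1))"
    by (auto simp: fun_eq_iff slice_emb_def vec_eq_iff forall_3 axis_def)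
  have n: "Ck_on k (\<lambda>y::real^2. y $ i) UNIV" for i
    by (simp add: Ck_on_bounded_linear bounded_linear_vec_nth)
  show ?thesis unfolding e
    by (intro Ck_on_add Ck_on_scaleR Ck_on_const n open_UNIV)
qed

lemma smooth_chart_slice:
  assumes "linear R"
  shows "Ck_on k (chart L R \<circ> slice_emb s) UNIV"
proof -
  have e: "chart L R \<circ> slice_emb s = (\<lambda>y. cos (pi / L * s) *\<^sub>R (1, 0) +
     ((sin (pi / L * s) * (cos (y$1) * cos (y$2))) *\<^sub>R (0, R (axis 1 1)) +
     ((sin (pi / L * s) * (cos (y$1) * sin (y$2))) *\<^sub>R (0, R (axis 2 1)) +
     (sin (pi / L * s) * (sin (y$1))) *\<^sub>R (0, R (axis 3 1)))))"
    by (rule ext)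
     (simp add: slice_emb_def chart_def polar_def sph_alt linear_add[OF assms] linear_scale[OF assms] prod_eq_iff scaleR_add_right mult.commute)
  have n: "Ck_on k (\<lambda>y::real^2. y $ i) UNIV" for i
    by (simp add: Ck_on_bounded_linear bounded_linear_vec_nth)
  show ?thesis unfolding e
    by (intro Ck_on_add Ck_on_scaleR Ck_on_mult Ck_on_const n Ck_on_sin_cos[THEN conjunct1] Ck_on_sin_cos[THEN conjunct2] open_UNIV)
qed

text \<open>
  The components of the direction along the rotated frame \<open>R (axis i 1)\<close> are inner products, so the inverse
  of \<open>R\<close> does not appear.  Latitude is written with an arctangent rather than an arcsine, which makes
  continuity evident on the whole half space where the first component is positive.
\<close>

definition chart_inv :: "real \<Rightarrow> (real^3 \<Rightarrow> real^3) \<Rightarrow> real \<times> (real^3) \<Rightarrow> real^3" where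
  "chart_inv L R p = vector [L / pi * arccos (fst p),
     arctan ((snd p \<bullet> R (axis 3 1)) / sqrt ((snd p \<bullet> R (axis 1 1))\<^sup>2 + (snd p \<bullet> R (axis 2 1))\<^sup>2)),
     arctan ((snd p \<bullet> R (axis 2 1)) / (snd p \<bullet> R (axis 1 1)))]"

lemma open_chart_dom: "open (chart_dom L)"
  unfolding chart_dom_def greaterThanLessThan_iff
  by (intro open_Collect_conj open_Collect_less continuous_intros)

lemma open_slice_dom: "open slice_dom"
  unfolding slice_dom_def greaterThanLessThan_iff
  by (intro open_Collect_conj open_Collect_less continuous_intros)

lemma chart_dom_sin_pos: "y \<in> chart_dom L \<Longrightarrow> 0 < sin (pi * y$1 / L)"
  by (auto simp: chart_dom_def field_simps intro!: sin_gt_zero)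

lemma chart_dom_cos_pos: "y \<in> chart_dom L \<Longrightarrow> 0 < cos (y$2)" "y \<in> chart_dom L \<Longrightarrow> 0 < cos (y$3)"
  by (auto simp: chart_dom_def intro!: cos_gt_zero_pi)

lemma slice_emb_in_chart_dom: "slice_emb s x \<in> chart_dom L \<longleftrightarrow> s \<in> {0<..<L} \<and> x \<in> slice_dom"
  by (auto simp: slice_emb_def chart_dom_def slice_dom_def)

lemma chart_inner_axis:
  assumes "orthogonal_transformation R"
  shows "snd (chart L R y) \<bullet> R (axis i 1) = sin (pi * y$1 / L) * sph (y$2) (y$3) $ i"
  using assms by (simp add: chart_def polar_def orthogonal_transformation_def inner_axis)

lemma chart_in_S3:
  assumes "orthogonal_transformation R"
  shows "chart L R y \<in> S3"
proof -
  have "R (sph (y$2) (y$3)) \<bullet> R (sph (y$2) (y$3)) = 1"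
    using assms by (simp add: orthogonal_transformation_def inner_sph_sph)
  then have "chart L R y \<bullet> chart L R y = 1"
    by (simp add: chart_def polar_def inner_Pair power2_eq_square[symmetric] mult.assoc[symmetric])
  then show ?thesis by (simp add: norm_eq_sqrt_inner)
qed

lemma chart_inv_chart:
  assumes R: "orthogonal_transformation R" and y: "y \<in> chart_dom L"
  shows "chart_inv L R (chart L R y) = y"
proof -
  have L: "L > 0" using y by (auto simp: chart_dom_def)
  define S where "S = sin (pi * y$1 / L)"
  have S: "S > 0" using chart_dom_sin_pos[OF y] by (simp add: S_def)
  note c = chart_dom_cos_pos[OF y]
  have "0 \<le> pi * y$1 / L" "pi * y$1 / L \<le> pi"
    using y L by (auto simp: chart_dom_def field_simps)
  then have "arccos (fst (chart L R y)) = pi * y$1 / L"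
    by (simp add: chart_def polar_def arccos_cos)
  then have 1: "L / pi * arccos (fst (chart L R y)) = y$1" using L by simp
  have "(S * (cos (y$2) * cos (y$3)))\<^sup>2 + (S * (cos (y$2) * sin (y$3)))\<^sup>2 = (S * cos (y$2))\<^sup>2 * ((cos (y$3))\<^sup>2 + (sin (y$3))\<^sup>2)"
    by algebra
  then have "sqrt ((S * (cos (y$2) * cos (y$3)))\<^sup>2 + (S * (cos (y$2) * sin (y$3)))\<^sup>2) = S * cos (y$2)"
    using S c by simp
  then have 2: "(S * sin (y$2)) / sqrt ((S * (cos (y$2) * cos (y$3)))\<^sup>2 + (S * (cos (y$2) * sin (y$3)))\<^sup>2) = tan (y$2)"
    using S by (simp add: tan_def)
  have 3: "(S * (cos (y$2) * sin (y$3))) / (S * (cos (y$2) * cos (y$3))) = tan (y$3)"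
    using S c by (simp add: tan_def)
  have "arctan (tan (y$2)) = y$2" "arctan (tan (y$3)) = y$3"
    using y by (auto simp: chart_dom_def intro!: arctan_tan)
  with 1 2 3 show ?thesis
    unfolding chart_inv_def chart_inner_axis[OF R] S_def[symmetric]
    by (simp add: sph_def vec_eq_iff forall_3)
qed

lemma chart_chart_inv:
  assumes R: "orthogonal_transformation R" and L: "L > 0" and p: "p \<in> S3" "snd p \<bullet> R (axis 1 1) > 0"
  shows "chart L R (chart_inv L R p) = p" "chart_inv L R p \<in> chart_dom L"
proof -
  obtain w where w: "snd p = R w"
    using orthogonal_transformation_surj[OF R] by (metis surjD)
  have wi: "snd p \<bullet> R (axis i 1) = w $ i" for i
    using R by (simp add: w orthogonal_transformation_def inner_axis)
  define t where "t = fst p"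
  define N where "N = sqrt (1 - t\<^sup>2)"
  define r where "r = sqrt ((w$1)\<^sup>2 + (w$2)\<^sup>2)"
  have w1: "w$1 > 0" using p wi by simp
  have "p \<bullet> p = 1" using p(1) by (simp add: norm_eq_sqrt_inner)
  then have "t\<^sup>2 + w \<bullet> w = 1"
    using R by (simp add: inner_prod_def t_def w orthogonal_transformation_def power2_eq_square)
  then have tw: "t\<^sup>2 + ((w$1)\<^sup>2 + (w$2)\<^sup>2 + (w$3)\<^sup>2) = 1"
    by (simp add: inner_vec_def sum_3 power2_eq_square)
  have w1': "(w$1)\<^sup>2 > 0" using w1 by simp
  have "t\<^sup>2 < 1\<^sup>2" using tw w1' by (smt (verit) one_power2 zero_le_power2)
  then have t: "-1 < t" "t < 1" using abs_square_less_1[of t] by auto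
  have r: "r > 0" using w1 unfolding r_def by (simp add: add_pos_nonneg)
  have r2: "r\<^sup>2 = (w$1)\<^sup>2 + (w$2)\<^sup>2" by (simp add: r_def)
  have N: "N > 0" "N\<^sup>2 = r\<^sup>2 + (w$3)\<^sup>2"
    using tw \<open>t\<^sup>2 < 1\<^sup>2\<close> r2 by (auto simp: N_def)
  have s1: "sqrt (1 + (w$3 / r)\<^sup>2) = N / r"
    using N r by (intro real_sqrt_unique) (auto simp: power_divide field_simps)
  have s2: "sqrt (1 + (w$2 / w$1)\<^sup>2) = r / w$1"
    using w1 r r2 by (intro real_sqrt_unique) (auto simp: power_divide field_simps)
  have "sph (arctan (w$3/r)) (arctan (w$2/w$1)) = (1/N) *\<^sub>R w"
    using N r w1 by (simp add: sph_def vec_eq_iff forall_3 sin_arctan cos_arctan s1 s2)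
  then have "R (sph (arctan (w$3/r)) (arctan (w$2/w$1))) = (1/N) *\<^sub>R R w"
    using R by (simp add: orthogonal_transformation_linear linear_scale)
  moreover have "sin (arccos t) = N" "cos (arccos t) = t"
    using t by (auto simp: N_def sin_arccos)
  ultimately show "chart L R (chart_inv L R p) = p"
    using N L
    by (simp add: chart_def chart_inv_def wi r_def[symmetric] t_def[symmetric] w[symmetric] polar_def prod_eq_iff)
  show "chart_inv L R p \<in> chart_dom L"
    using L arccos_lt_bounded[OF t] arctan_bounded
    by (simp add: chart_dom_def chart_inv_def t_def[symmetric]) (simp add: field_simps)
qed

lemma continuous_on_chart_inv:
  "continuous_on {p\<in>S3. snd p \<bullet> R (axis 1 1) > 0} (chart_inv L R)"
proof -
  have e: "chart_inv L R = (\<lambda>p. (L / pi * arccos (fst p)) *\<^sub>R axis 1 1 +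
     arctan ((snd p \<bullet> R (axis 3 1)) / sqrt ((snd p \<bullet> R (axis 1 1))\<^sup>2 + (snd p \<bullet> R (axis 2 1))\<^sup>2)) *\<^sub>R axis 2 1 +
     arctan ((snd p \<bullet> R (axis 2 1)) / (snd p \<bullet> R (axis 1 1))) *\<^sub>R axis 3 1)"
    by (rule ext) (simp add: chart_inv_def vec_eq_iff forall_3 axis_def)
  have nf: "norm (fst p) \<le> 1" if "p \<in> S3" for p :: "real \<times> (real^3)"
    using norm_fst_le[of "fst p" "snd p"] that by simp
  then have b: "-1 \<le> fst p" "fst p \<le> 1" if "p \<in> S3" for p :: "real \<times> (real^3)"
    using nf[OF that] by (auto simp: abs_le_iff)
  have z: "(snd p \<bullet> R (axis 1 1))\<^sup>2 + (snd p \<bullet> R (axis 2 1))\<^sup>2 \<noteq> 0" if "snd p \<bullet> R (axis 1 1) > 0" for p :: "real \<times> (real^3)"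
    using that by (smt (verit) zero_le_power2 zero_less_power2)
  show ?thesis unfolding e
    by (intro continuous_intros) (use b z in auto)
qed

text \<open>
  The polar part of the differential determines the first component of a tangent vector, and
  \<open>dsph\<close> preserves the length of the rest up to the factor \<open>cos \<alpha>\<close>, which is nonzero in the domain.
\<close>

lemma inj_chart_derivative:
  assumes R: "orthogonal_transformation R" and y: "y \<in> chart_dom L"
  shows "inj (frechet_derivative (chart L R) (at y))"
proof -
  note lin = orthogonal_transformation_linear[OF R]
  have L: "L > 0" using y by (auto simp: chart_dom_def)
  note S = chart_dom_sin_pos[OF y]
  note c = chart_dom_cos_pos[OF y]
  have "linear (frechet_derivative (chart L R) (at y))"
    using has_derivative_linear[OF has_derivative_chart[OF lin]] by (simp only: frechet_derivative_chart[OF lin])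
  moreover have "u = 0" if u: "frechet_derivative (chart L R) (at y) u = 0" for u
  proof -
    have *: "- sin (pi * y$1 / L) * (pi / L) * u$1 = 0"
      and **: "(cos (pi * y$1 / L) * (pi / L) * u$1) *\<^sub>R R (sph (y$2) (y$3)) + sin (pi * y$1 / L) *\<^sub>R R (dsph (y$2) (y$3) (u$2) (u$3)) = 0"
      using u by (simp_all add: frechet_derivative_chart[OF lin] frechet_derivative_polar prod_eq_iff)
    from * have u1: "u$1 = 0" using S L by simp
    with ** S have "R (dsph (y$2) (y$3) (u$2) (u$3)) = 0" by simp
    then have "norm (dsph (y$2) (y$3) (u$2) (u$3)) = 0"
      using orthogonal_transformation_norm[OF R, of "dsph (y$2) (y$3) (u$2) (u$3)"] by simp
    then have "dsph (y$2) (y$3) (u$2) (u$3) \<bullet> dsph (y$2) (y$3) (u$2) (u$3) = 0" by simp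
    then have "(u$2)\<^sup>2 + (cos (y$2) * u$3)\<^sup>2 = 0"
      by (simp add: inner_dsph_dsph power2_eq_square mult.assoc mult.left_commute)
    then have "u$2 = 0" "cos (y$2) * u$3 = 0" by (simp_all add: sum_power2_eq_zero_iff)
    with u1 c show "u = 0" by (simp add: vec_eq_iff forall_3)
  qed
  ultimately show ?thesis by (simp add: linear_injective_0)
qed

text \<open>
  The image is cut out of the sphere by an open half space; this makes its openness immediate.
\<close>

lemma chart_image:
  assumes R: "orthogonal_transformation R" and L: "L > 0"
  shows "chart L R ` chart_dom L = {p\<in>S3. snd p \<bullet> R (axis 1 1) > 0}" (is "_ = ?T")
proof
  show "chart L R ` chart_dom L \<subseteq> ?T"
    using chart_in_S3[OF R] chart_dom_sin_pos chart_dom_cos_pos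
    by (auto simp: chart_inner_axis[OF R] sph_def simp del: mem_sphere_0)
  show "?T \<subseteq> chart L R ` chart_dom L"
  proof
    fix p assume "p \<in> ?T"
    then have "p \<in> S3" "snd p \<bullet> R (axis 1 1) > 0" by auto
    from chart_chart_inv[OF R L this] show "p \<in> chart L R ` chart_dom L" by (rule image_eqI[OF sym])
  qed
qed

lemma homeomorphism_chart:
  assumes R: "orthogonal_transformation R" and L: "L > 0"
  shows "homeomorphism (chart_dom L) {p\<in>S3. snd p \<bullet> R (axis 1 1) > 0} (chart L R) (chart_inv L R)"
proof (rule homeomorphismI)
  let ?T = "{p\<in>S3. snd p \<bullet> R (axis 1 1) > 0}"
  show "continuous_on (chart_dom L) (chart L R)"
    by (rule continuous_on_subset[OF smooth_chart[OF orthogonal_transformation_linear[OF R], of 0 L, unfolded Ck_on.simps]]) simp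
  show "continuous_on ?T (chart_inv L R)" by (rule continuous_on_chart_inv[of R L])
  show "chart L R ` chart_dom L \<subseteq> ?T" by (rule equalityD1[OF chart_image[OF R L]])
  show "chart_inv L R ` ?T \<subseteq> chart_dom L"
  proof (rule image_subsetI)
    fix p assume "p \<in> ?T"
    then have "p \<in> S3" "snd p \<bullet> R (axis 1 1) > 0" by (simp_all only: mem_Collect_eq)
    then show "chart_inv L R p \<in> chart_dom L" by (rule chart_chart_inv(2)[OF R L])
  qed
  show "chart_inv L R (chart L R y) = y" if "y \<in> chart_dom L" for y
    by (rule chart_inv_chart[OF R that])
  show "chart L R (chart_inv L R p) = p" if p: "p \<in> ?T" for p
  proof -
    have "p \<in> S3" "snd p \<bullet> R (axis 1 1) > 0" using p by (simp_all only: mem_Collect_eq)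
    then show ?thesis by (rule chart_chart_inv(1)[OF R L])
  qed
qed

lemma openin_half:
  "openin (top_of_set X) {p\<in>X. snd p \<bullet> (c::'a::real_inner) > 0}"
proof -
  have "open {p::('b::topological_space \<times> 'a). snd p \<bullet> c > 0}"
    by (intro open_Collect_less continuous_intros)
  from openin_open_Int[OF this, of X] show ?thesis
    by (simp add: Int_def)
qed

lemma local_param_chart:
  assumes R: "orthogonal_transformation R" and L: "L > 0"
  shows "local_param S3 (chart_dom L) (chart L R)"
  unfolding local_param_def
proof (intro conjI ballI)
  show "smooth_on (chart_dom L) (chart L R)"
    by (rule Ck_on_imp_smooth_on[OF open_UNIV smooth_chart[OF orthogonal_transformation_linear[OF R]]]) auto
  show "openin (top_of_set S3) (chart L R ` chart_dom L)"
    unfolding chart_image[OF R L] by (rule openin_half)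
  show "\<exists>\<rho>. homeomorphism (chart_dom L) (chart L R ` chart_dom L) (chart L R) \<rho>"
    unfolding chart_image[OF R L] using homeomorphism_chart[OF R L] by blast
qed (rule open_chart_dom, rule inj_chart_derivative[OF R])

definition slice :: "real \<Rightarrow> real \<Rightarrow> (real \<times> (real^3)) set" where
  "slice L s = {p \<in> S3. fst p = cos (pi * s / L)}"

lemma slice_chart_image:
  assumes R: "orthogonal_transformation R" and s: "s \<in> {0<..<L}"
  shows "(chart L R \<circ> slice_emb s) ` slice_dom = {p\<in>slice L s. snd p \<bullet> R (axis 1 1) > 0}" (is "?I = ?T")
    and "\<And>p. p \<in> slice L s \<Longrightarrow> snd p \<bullet> R (axis 1 1) > 0 \<Longrightarrow>
        slice_emb s (vector [chart_inv L R p $ 2, chart_inv L R p $ 3]) = chart_inv L R p"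
proof -
  have L: "L > 0" using s by auto
  show E: "slice_emb s (vector [chart_inv L R p $ 2, chart_inv L R p $ 3]) = chart_inv L R p"
    if "p \<in> slice L s" "snd p \<bullet> R (axis 1 1) > 0" for p
  proof -
    have "arccos (cos (pi * s / L)) = pi * s / L" using s L by (intro arccos_cos) (auto simp: field_simps)
    with that L have "chart_inv L R p $ 1 = s" by (simp add: slice_def chart_inv_def)
    then show ?thesis by (simp add: slice_emb_def vec_eq_iff forall_3)
  qed
  show "?I = ?T"
  proof
    show "?I \<subseteq> ?T"
    proof (rule image_subsetI)
      fix x assume "x \<in> slice_dom"
      then have "slice_emb s x \<in> chart_dom L" using s by (simp add: slice_emb_in_chart_dom)
      then have "chart L R (slice_emb s x) \<in> {p\<in>S3. snd p \<bullet> R (axis 1 1) > 0}"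
        using chart_image[OF R L] by blast
      then show "(chart L R \<circ> slice_emb s) x \<in> ?T"
        by (auto simp: slice_def chart_def polar_def slice_emb_def)
    qed
    show "?T \<subseteq> ?I"
    proof
      fix p assume p: "p \<in> ?T"
      then have p': "p \<in> S3" "snd p \<bullet> R (axis 1 1) > 0" by (auto simp: slice_def)
      let ?x = "vector [chart_inv L R p $ 2, chart_inv L R p $ 3] :: real^2"
      have e: "slice_emb s ?x = chart_inv L R p" using E p by blast
      have "?x \<in> slice_dom"
        using chart_chart_inv(2)[OF R L p'] e slice_emb_in_chart_dom by metis
      moreover have "(chart L R \<circ> slice_emb s) ?x = p"
        using chart_chart_inv(1)[OF R L p'] e by simp
      ultimately show "p \<in> ?I" by (metis imageI)
    qed
  qed
qed

lemma homeomorphism_slice_chart: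
  assumes R: "orthogonal_transformation R" and s: "s \<in> {0<..<L}"
  shows "homeomorphism slice_dom {p\<in>slice L s. snd p \<bullet> R (axis 1 1) > 0}
     (chart L R \<circ> slice_emb s) (\<lambda>p. vector [chart_inv L R p $ 2, chart_inv L R p $ 3])"
    (is "homeomorphism _ ?T _ ?g")
proof (rule homeomorphismI)
  have L: "L > 0" using s by auto
  show "continuous_on slice_dom (chart L R \<circ> slice_emb s)"
    by (rule continuous_on_subset[OF smooth_chart_slice[OF orthogonal_transformation_linear[OF R], of 0 L, unfolded Ck_on.simps]]) simp
  have "?g = (\<lambda>p. chart_inv L R p $ 2 *\<^sub>R axis 1 1 + chart_inv L R p $ 3 *\<^sub>R axis 2 1)"
    by (rule ext) (simp add: vec_eq_iff forall_2 axis_def)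
  moreover have "continuous_on ?T (chart_inv L R)"
    by (rule continuous_on_subset[OF continuous_on_chart_inv]) (auto simp: slice_def)
  ultimately show "continuous_on ?T ?g" by (simp only:) (intro continuous_intros)
  show gf: "?g ((chart L R \<circ> slice_emb s) x) = x" if "x \<in> slice_dom" for x
  proof -
    have "chart_inv L R (chart L R (slice_emb s x)) = slice_emb s x"
      using chart_inv_chart[OF R] that s slice_emb_in_chart_dom by blast
    then show ?thesis by (simp add: slice_emb_def vec_eq_iff forall_2)
  qed
  show fg: "(chart L R \<circ> slice_emb s) (?g p) = p" if "p \<in> ?T" for p
    using slice_chart_image(2)[OF R s] chart_chart_inv(1)[OF R L] that by (auto simp: slice_def)
  show "(chart L R \<circ> slice_emb s) ` slice_dom \<subseteq> ?T" using slice_chart_image(1)[OF R s] by simp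
  show "?g ` ?T \<subseteq> slice_dom"
    unfolding slice_chart_image(1)[OF R s, symmetric] using gf by auto
qed

lemma local_param_slice_chart:
  assumes R: "orthogonal_transformation R" and s: "s \<in> {0<..<L}"
  shows "local_param (slice L s) slice_dom (chart L R \<circ> slice_emb s)"
  unfolding local_param_def
proof (intro conjI ballI)
  note lin = orthogonal_transformation_linear[OF R]
  show "smooth_on slice_dom (chart L R \<circ> slice_emb s)"
    by (rule Ck_on_imp_smooth_on[OF open_UNIV smooth_chart_slice[OF lin]]) auto
  show "inj (frechet_derivative (chart L R \<circ> slice_emb s) (at x))" if "x \<in> slice_dom" for x
  proof -
    have "frechet_derivative (chart L R \<circ> slice_emb s) (at x)
        = frechet_derivative (chart L R) (at (slice_emb s x)) \<circ> frechet_derivative (slice_emb s) (at x)"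
      by (rule frechet_derivative_compose[OF differentiableI[OF has_derivative_slice_emb] differentiableI[OF has_derivative_chart[OF lin]]])
    moreover have "inj (frechet_derivative (slice_emb s) (at x))"
      unfolding frechet_derivative_slice_emb by (rule injI) (auto simp: vec_eq_iff forall_2 forall_3)
    moreover have "inj (frechet_derivative (chart L R) (at (slice_emb s x)))"
      by (rule inj_chart_derivative[OF R]) (use that s slice_emb_in_chart_dom in blast)
    ultimately show ?thesis by (simp add: inj_compose)
  qed
  show "openin (top_of_set (slice L s)) ((chart L R \<circ> slice_emb s) ` slice_dom)"
    unfolding slice_chart_image(1)[OF R s] by (rule openin_half)
  show "\<exists>\<rho>. homeomorphism slice_dom ((chart L R \<circ> slice_emb s) ` slice_dom) (chart L R \<circ> slice_emb s) \<rho>"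
    unfolding slice_chart_image(1)[OF R s] using homeomorphism_slice_chart[OF R s] by blast
qed (rule open_slice_dom)

definition warped_matrix :: "(real \<Rightarrow> real) \<Rightarrow> real^3 \<Rightarrow> real^3^3" where
  "warped_matrix f y = (\<chi> i j. if i \<noteq> j then 0 else if i = 1 then 1
      else if i = 2 then (f (y$1))\<^sup>2 else (f (y$1))\<^sup>2 * (cos (y$2))\<^sup>2)"

lemma polar_metric:
  assumes "rot_symmetric_sphere L f g" "s \<in> {0<..<L}" "w \<in> S2" "u \<bullet> w = 0" "v \<bullet> w = 0"
  shows "g (polar L (s, w)) (frechet_derivative (polar L) (at (s, w)) (c, u))
          (frechet_derivative (polar L) (at (s, w)) (d, v)) = c * d + (f s)\<^sup>2 * (u \<bullet> v)"
  using assms unfolding rot_symmetric_sphere_def by blast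

text \<open>
  Rotations preserve inner products and the directions \<open>dsph\<close> are tangent to the sphere, so the polar form
  of the metric applies to the coordinate vectors; they are orthogonal, since latitude and longitude are.
\<close>

lemma coord_metric_chart:
  assumes g: "rot_symmetric_sphere L f g" and R: "orthogonal_transformation R" and y: "y \<in> chart_dom L"
  shows "coord_metric g (chart L R) y = warped_matrix f y"
proof -
  note lin = orthogonal_transformation_linear[OF R]
  let ?w = "R (sph (y$2) (y$3))"
  have ip: "R a \<bullet> R b = a \<bullet> b" for a b using R by (simp add: orthogonal_transformation_def)
  have "?w \<in> S2" by (simp add: norm_eq_sqrt_inner ip inner_sph_sph)
  moreover have "y$1 \<in> {0<..<L}" using y by (simp add: chart_dom_def)
  ultimately have *: "coord_metric g (chart L R) y $ i $ j = (axis i 1 $ 1) * (axis j 1 $ 1) + (f (y$1))\<^sup>2 *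
      (dsph (y$2) (y$3) (axis i 1 $ 2) (axis i 1 $ 3) \<bullet> dsph (y$2) (y$3) (axis j 1 $ 2) (axis j 1 $ 3))" for i j
    unfolding coord_metric_def pd_def frechet_derivative_chart[OF lin] chart_def
    by (simp add: polar_metric[OF g] ip inner_dsph_sph)
  show ?thesis
    by (simp add: vec_eq_iff forall_3 * inner_dsph_dsph warped_matrix_def) (simp add: axis_def)
qed

lemma exists_rotation:
  assumes "(w::real^3) \<in> S2"
  obtains R :: "real^3 \<Rightarrow> real^3" where "orthogonal_transformation R" "R (axis 1 1) = w"
proof -
  have "norm (axis 1 1 :: real^3) = 1" "norm w = 1" using assms by simp_all
  then obtain R :: "real^3 \<Rightarrow> real^3" where "orthogonal_transformation R" "R (axis 1 1) = w"
    by (rule orthogonal_transformation_exists_1) blast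
  then show thesis by (rule that)
qed

section \<open>Curvature of a warped product\<close>

lemma matrix_inv_eqI:
  fixes A :: "real^'n^'n"
  assumes "A ** B = mat 1" "B ** A = mat 1"
  shows "matrix_inv A = B"
proof -
  have i: "A ** matrix_inv A = mat 1 \<and> matrix_inv A ** A = mat 1"
    unfolding matrix_inv_def by (rule someI[of _ B]) (use assms in simp)
  have "matrix_inv A = matrix_inv A ** (A ** B)" by (simp add: assms)
  also have "\<dots> = B" using i by (simp add: matrix_mul_assoc)
  finally show ?thesis .
qed

lemma matrix_inv_warped:
  assumes "f (y$1) \<noteq> 0" "cos (y$2) \<noteq> 0"
  shows "matrix_inv (warped_matrix f y) = (\<chi> i j. if i \<noteq> j then 0 else if i = 1 then 1
      else if i = 2 then 1 / (f (y$1))\<^sup>2 else 1 / ((f (y$1))\<^sup>2 * (cos (y$2))\<^sup>2))"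
  by (rule matrix_inv_eqI)
    (use assms in \<open>simp_all add: vec_eq_iff forall_3 matrix_matrix_mult_def sum_3 mat_def warped_matrix_def\<close>)

text \<open>
  All coefficients of the metric and all Christoffel symbols are products of a function of arc length and a
  function of latitude, so this single rule computes all the partial derivatives that do not vanish.
\<close>

lemma pd_separated:
  fixes x :: "real^3"
  assumes "open W" "x \<in> W" "\<And>y. y \<in> W \<Longrightarrow> F y = a (y$1) * b (y$2)"
    and a: "(a has_real_derivative a') (at (x$1))" and b: "(b has_real_derivative b') (at (x$2))"
  shows "pd 1 F x = a' * b (x$2)" "pd 2 F x = a (x$1) * b'" "pd 3 F x = 0"
proof -
  have n: "((\<lambda>y::real^3. y$i) has_derivative (\<lambda>u. u$i)) (at x)" for i
    by (rule bounded_linear_imp_has_derivative[OF bounded_linear_vec_nth])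
  have "((\<lambda>y. a (y$1) * b (y$2)) has_derivative (\<lambda>u. a (x$1) * (b' * u$2) + (a' * u$1) * b (x$2))) (at x)"
    using a b
    by (intro has_derivative_mult has_derivative_compose[OF n, of a "(*) a'" 1, simplified]
        has_derivative_compose[OF n, of b "(*) b'" 2, simplified]) (simp_all add: has_field_derivative_def)
  then have "(F has_derivative (\<lambda>u. a (x$1) * (b' * u$2) + (a' * u$1) * b (x$2))) (at x)"
    by (rule has_derivative_transform_within_open) (use assms in auto)
  from frechet_derivative_at[OF this, symmetric]
  show "pd 1 F x = a' * b (x$2)" "pd 2 F x = a (x$1) * b'" "pd 3 F x = 0"
    by (simp_all add: pd_def axis_def)
qed

lemma pd_const_on:
  fixes x :: "real^3"
  assumes "open W" "x \<in> W" "\<And>y. y \<in> W \<Longrightarrow> F y = (c::real)"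
  shows "pd i F x = 0"
proof -
  have "(F has_derivative (\<lambda>u. 0)) (at x)"
    by (rule has_derivative_transform_within_open[OF has_derivative_const assms(1,2), of c]) (use assms(3) in auto)
  from frechet_derivative_at[OF this, symmetric] show ?thesis by (simp add: pd_def)
qed

text \<open>
  The nonzero Christoffel symbols of \<open>ds\<^sup>2 + f\<^sup>2 (d\<alpha>\<^sup>2 + cos\<^sup>2 \<alpha> d\<beta>\<^sup>2)\<close>, with \<open>f'\<close> the derivative of \<open>f\<close>.
\<close>

definition warped_christoffel :: "(real \<Rightarrow> real) \<Rightarrow> (real \<Rightarrow> real) \<Rightarrow> 3 \<Rightarrow> 3 \<Rightarrow> 3 \<Rightarrow> real^3 \<Rightarrow> real" where
  "warped_christoffel f f' k i j y =
    (if k = 1 \<and> i = 2 \<and> j = 2 then - (f (y$1) * f' (y$1))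
     else if k = 1 \<and> i = 3 \<and> j = 3 then - (f (y$1) * f' (y$1)) * (cos (y$2))\<^sup>2
     else if k = 2 \<and> (i = 1 \<and> j = 2 \<or> i = 2 \<and> j = 1) then f' (y$1) / f (y$1)
     else if k = 3 \<and> (i = 1 \<and> j = 3 \<or> i = 3 \<and> j = 1) then f' (y$1) / f (y$1)
     else if k = 2 \<and> i = 3 \<and> j = 3 then sin (y$2) * cos (y$2)
     else if k = 3 \<and> (i = 2 \<and> j = 3 \<or> i = 3 \<and> j = 2) then - tan (y$2)
     else 0)"

locale warped_coordinates =
  fixes W :: "(real^3) set" and G :: "real^3 \<Rightarrow> real^3^3" and f f' f'' :: "real \<Rightarrow> real"
  assumes open_W: "open W" and G: "\<And>y. y \<in> W \<Longrightarrow> G y = warped_matrix f y"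
    and f_pos: "\<And>y. y \<in> W \<Longrightarrow> f (y$1) > 0" and cos_pos: "\<And>y. y \<in> W \<Longrightarrow> cos (y$2) > 0"
    and f': "\<And>y. y \<in> W \<Longrightarrow> (f has_real_derivative f' (y$1)) (at (y$1))"
    and f'': "\<And>y. y \<in> W \<Longrightarrow> (f' has_real_derivative f'' (y$1)) (at (y$1))"
begin

lemma pd_G:
  assumes y: "y \<in> W"
  shows "i \<noteq> j \<Longrightarrow> pd k (\<lambda>y. G y $ i $ j) y = 0" "pd k (\<lambda>y. G y $ 1 $ 1) y = 0"
    "pd 1 (\<lambda>y. G y $ 2 $ 2) y = 2 * f (y$1) * f' (y$1)" "pd 2 (\<lambda>y. G y $ 2 $ 2) y = 0" "pd 3 (\<lambda>y. G y $ 2 $ 2) y = 0"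
    "pd 1 (\<lambda>y. G y $ 3 $ 3) y = 2 * f (y$1) * f' (y$1) * (cos (y$2))\<^sup>2"
    "pd 2 (\<lambda>y. G y $ 3 $ 3) y = - 2 * (f (y$1))\<^sup>2 * sin (y$2) * cos (y$2)" "pd 3 (\<lambda>y. G y $ 3 $ 3) y = 0"
proof -
  have d: "((\<lambda>s. (f s)\<^sup>2) has_real_derivative 2 * f (y$1) * f' (y$1)) (at (y$1))"
    using f'[OF y] by (auto intro!: derivative_eq_intros)
  have d1: "((\<lambda>s. 1) has_real_derivative 0) (at (y$2))" by simp
  have d2: "((\<lambda>s. (cos s)\<^sup>2) has_real_derivative - 2 * sin (y$2) * cos (y$2)) (at (y$2))"
    by (auto intro!: derivative_eq_intros)
  show "i \<noteq> j \<Longrightarrow> pd k (\<lambda>y. G y $ i $ j) y = 0" "pd k (\<lambda>y. G y $ 1 $ 1) y = 0"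
    by (rule pd_const_on[OF open_W y], simp add: G warped_matrix_def)+
  have "G z $ 2 $ 2 = (f (z$1))\<^sup>2 * 1" "G z $ 3 $ 3 = (f (z$1))\<^sup>2 * (cos (z$2))\<^sup>2" if "z \<in> W" for z
    using that by (simp_all add: G warped_matrix_def)
  from pd_separated[OF open_W y this(1) d d1] pd_separated[OF open_W y this(2) d d2]
  show "pd 1 (\<lambda>y. G y $ 2 $ 2) y = 2 * f (y$1) * f' (y$1)" "pd 2 (\<lambda>y. G y $ 2 $ 2) y = 0" "pd 3 (\<lambda>y. G y $ 2 $ 2) y = 0"
    "pd 1 (\<lambda>y. G y $ 3 $ 3) y = 2 * f (y$1) * f' (y$1) * (cos (y$2))\<^sup>2"
    "pd 2 (\<lambda>y. G y $ 3 $ 3) y = - 2 * (f (y$1))\<^sup>2 * sin (y$2) * cos (y$2)" "pd 3 (\<lambda>y. G y $ 3 $ 3) y = 0"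
    by (simp_all add: mult.assoc)
qed

lemma christoffel_G:
  assumes y: "y \<in> W"
  shows "christoffel G k i j y = warped_christoffel f f' k i j y"
proof -
  have nz: "f (y$1) \<noteq> 0" "cos (y$2) \<noteq> 0" using f_pos[OF y] cos_pos[OF y] by auto
  have "\<forall>k i j. christoffel G k i j y = warped_christoffel f f' k i j y"
    unfolding forall_3 christoffel_def sum_3 G[OF y] matrix_inv_warped[of f y, OF nz]
    using nz by (simp add: pd_G[OF y] warped_christoffel_def) (simp add: field_simps power2_eq_square tan_def)
  then show ?thesis by blast
qed

lemma pd_christoffel:
  assumes y: "y \<in> W"
  defines "q \<equiv> (f' (y$1))\<^sup>2 + f (y$1) * f'' (y$1)"
    and "p \<equiv> (f'' (y$1) * f (y$1) - (f' (y$1))\<^sup>2) / (f (y$1))\<^sup>2"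
  shows "pd 1 (christoffel G 1 2 2) y = - q" "pd 1 (christoffel G 1 3 3) y = - q * (cos (y$2))\<^sup>2"
    "pd 2 (christoffel G 2 3 3) y = (cos (y$2))\<^sup>2 - (sin (y$2))\<^sup>2"
    "pd 1 (christoffel G 2 1 2) y = p" "pd 1 (christoffel G 3 1 3) y = p"
    "pd 2 (christoffel G 3 2 3) y = - 1 / (cos (y$2))\<^sup>2"
    "\<And>k i j l. warped_christoffel f f' k i j = (\<lambda>_. 0) \<Longrightarrow> pd l (christoffel G k i j) y = 0"
proof -
  have nz: "f (y$1) \<noteq> 0" "cos (y$2) \<noteq> 0" using f_pos[OF y] cos_pos[OF y] by auto
  have c0: "((\<lambda>s. 1) has_real_derivative 0) (at t)" for t by simp
  have d1: "((\<lambda>s. - (f s * f' s)) has_real_derivative - q) (at (y$1))"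
    using f'[OF y] f''[OF y] by (auto intro!: derivative_eq_intros simp: q_def power2_eq_square)
  have d2: "((\<lambda>s. f' s / f s) has_real_derivative p) (at (y$1))"
    using f'[OF y] f''[OF y] nz by (auto intro!: derivative_eq_intros simp: p_def power2_eq_square)
  have e1: "((\<lambda>s. (cos s)\<^sup>2) has_real_derivative - 2 * sin (y$2) * cos (y$2)) (at (y$2))"
    by (auto intro!: derivative_eq_intros)
  have e2: "((\<lambda>s. sin s * cos s) has_real_derivative (cos (y$2))\<^sup>2 - (sin (y$2))\<^sup>2) (at (y$2))"
    by (auto intro!: derivative_eq_intros simp: power2_eq_square)
  have e3: "((\<lambda>s. - tan s) has_real_derivative - 1 / (cos (y$2))\<^sup>2) (at (y$2))"
    using nz by (auto intro!: derivative_eq_intros simp: divide_inverse)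
  note sep = pd_separated[OF open_W y]
  note W = christoffel_G warped_christoffel_def
  show "pd 1 (christoffel G 1 2 2) y = - q"
    by (subst sep(1)[OF _ d1 c0]) (simp_all add: W)
  show "pd 1 (christoffel G 1 3 3) y = - q * (cos (y$2))\<^sup>2"
    by (subst sep(1)[OF _ d1 e1]) (simp_all add: W)
  show "pd 2 (christoffel G 2 3 3) y = (cos (y$2))\<^sup>2 - (sin (y$2))\<^sup>2"
    by (subst sep(2)[OF _ c0 e2]) (simp_all add: W)
  show "pd 1 (christoffel G 2 1 2) y = p"
    by (subst sep(1)[OF _ d2 c0]) (simp_all add: W)
  show "pd 1 (christoffel G 3 1 3) y = p"
    by (subst sep(1)[OF _ d2 c0]) (simp_all add: W)
  show "pd 2 (christoffel G 3 2 3) y = - 1 / (cos (y$2))\<^sup>2"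
    by (subst sep(2)[OF _ c0 e3]) (simp_all add: W)
  show "pd l (christoffel G k i j) y = 0" if "warped_christoffel f f' k i j = (\<lambda>_. 0)" for k i j l
    by (rule pd_const_on[OF open_W y, of _ 0]) (simp add: christoffel_G that)
qed

text \<open>
  The inverse metric is diagonal, so only the diagonal entries of the Ricci tensor enter the trace.  The radial
  direction contributes \<open>-2 f''/f\<close>, each of the two spherical directions \<open>(1 - f'\<^sup>2 - f f'') / f\<^sup>2\<close>.
\<close>

lemma scalar_curv_G:
  assumes y: "y \<in> W"
  shows "scalar_curv G y = 2 * (1 - (f' (y$1))\<^sup>2) / (f (y$1))\<^sup>2 - 4 * f'' (y$1) / f (y$1)"
proof -
  have nz: "f (y$1) \<noteq> 0" "cos (y$2) \<noteq> 0" using f_pos[OF y] cos_pos[OF y] by auto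
  have zero: "pd l (christoffel G 1 1 j) y = 0" "pd l (christoffel G 1 i 1) y = 0"
    "pd l (christoffel G 2 1 1) y = 0" "pd l (christoffel G 3 1 1) y = 0"
    "pd l (christoffel G 2 2 2) y = 0" "pd l (christoffel G 3 2 2) y = 0" "pd l (christoffel G 3 3 3) y = 0"
    "pd l (christoffel G 2 2 3) y = 0" "pd l (christoffel G 2 3 2) y = 0" "pd l (christoffel G 1 2 3) y = 0"  "pd l (christoffel G 1 3 2) y = 0" for i j l
    by (rule pd_christoffel(7)[OF y]; simp add: warped_christoffel_def fun_eq_iff)+
  have R1: "ricci G 1 1 y = - 2 * f'' (y$1) / f (y$1)"
    unfolding ricci_def sum_3 christoffel_G[OF y]
    by (simp add: pd_christoffel[OF y] zero warped_christoffel_def) (use nz in \<open>simp add: field_simps power2_eq_square\<close>)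
  have R2: "ricci G 2 2 y = 1 - (f' (y$1))\<^sup>2 - f (y$1) * f'' (y$1)"
    unfolding ricci_def sum_3 christoffel_G[OF y]
    apply (simp add: pd_christoffel[OF y] zero warped_christoffel_def)
    using nz sin_squared_eq[of "y$2"] apply (simp add: field_simps power2_eq_square tan_def)
    done
  have R3: "ricci G 3 3 y = (cos (y$2))\<^sup>2 * (1 - (f' (y$1))\<^sup>2 - f (y$1) * f'' (y$1))"
    unfolding ricci_def sum_3 christoffel_G[OF y]
    apply (simp add: pd_christoffel[OF y] zero warped_christoffel_def)
    using nz sin_squared_eq[of "y$2"] apply (simp add: field_simps power2_eq_square tan_def)
    done
  show ?thesis
    unfolding scalar_curv_def sum_3 G[OF y] matrix_inv_warped[of f y, OF nz]
    using nz by (simp add: R1 R2 R3 field_simps power2_eq_square)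
qed

end

section \<open>The scalar curvature inequality for the warping function\<close>

lemma warping_function_derivatives:
  assumes "rot_symmetric_sphere L f g" "s \<in> {0<..<L}"
  shows "(f has_real_derivative deriv f s) (at s)" "(deriv f has_real_derivative deriv (deriv f) s) (at s)"
proof -
  have "smooth_on {0..L} f" using assms(1) by (simp add: rot_symmetric_sphere_def)
  then obtain U where U: "open U" "s \<in> U" "U \<subseteq> {0<..<L}" "\<And>k. Ck_on k f U"
    using smooth_on_interior[of "{0..L}" f "{0<..<L}" s] assms(2) by (auto simp: subset_eq)
  note 1 = Ck_on_deriv[OF U(1) U(4)]
  note 2 = Ck_on_deriv[OF U(1) 1(2)]
  show "(f has_real_derivative deriv f s) (at s)" using 1(1) U(2) .
  show "(deriv f has_real_derivative deriv (deriv f) s) (at s)" using 2(1) U(2) .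
qed

lemma warping_function_pos:
  "rot_symmetric_sphere L f g \<Longrightarrow> s \<in> {0<..<L} \<Longrightarrow> f s > 0"
  by (simp add: rot_symmetric_sphere_def)

lemma warped_coordinates_chart:
  assumes g: "rot_symmetric_sphere L f g" and R: "orthogonal_transformation R"
  shows "warped_coordinates (chart_dom L) (coord_metric g (chart L R)) f (deriv f) (deriv (deriv f))"
proof
  fix y assume y: "y \<in> chart_dom L"
  then have s: "y$1 \<in> {0<..<L}" by (simp add: chart_dom_def)
  show "coord_metric g (chart L R) y = warped_matrix f y" by (rule coord_metric_chart[OF g R y])
  show "f (y$1) > 0" by (rule warping_function_pos[OF g s])
  show "cos (y$2) > 0" by (rule chart_dom_cos_pos[OF y])
qed (use open_chart_dom warping_function_derivatives[OF g] in \<open>auto simp: chart_dom_def\<close>)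

text \<open>
  One chart suffices, evaluated at latitude and longitude zero: the curvature depends on arc length only.
\<close>

lemma scalar_curvature_inequality:
  assumes g: "rot_symmetric_sphere L f g" and sc: "nonneg_scalar3 S3 g" and s: "s \<in> {0<..<L}"
  shows "2 * f s * deriv (deriv f) s \<le> 1 - (deriv f s)\<^sup>2"
proof -
  have R: "orthogonal_transformation (id :: real^3 \<Rightarrow> real^3)" by (simp add: orthogonal_transformation_def linear_id)
  interpret warped_coordinates "chart_dom L" "coord_metric g (chart L id)" f "deriv f" "deriv (deriv f)"
    by (rule warped_coordinates_chart[OF g R])
  let ?y = "vector [s, 0, 0] :: real^3"
  have y: "?y \<in> chart_dom L" using s by (simp add: chart_dom_def)
  have "L > 0" using s by auto
  then have "0 \<le> scalar_curv (coord_metric g (chart L id)) ?y"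
    using local_param_chart[OF R] sc y unfolding nonneg_scalar3_def by blast
  then have "0 \<le> 2 * (1 - (deriv f s)\<^sup>2) / (f s)\<^sup>2 - 4 * deriv (deriv f) s / f s"
    by (simp add: scalar_curv_G[OF y])
  then have "0 \<le> (f s)\<^sup>2 * (2 * (1 - (deriv f s)\<^sup>2) / (f s)\<^sup>2 - 4 * deriv (deriv f) s / f s)"
    by simp
  also have "\<dots> = 2 * (1 - (deriv f s)\<^sup>2 - 2 * f s * deriv (deriv f) s)"
    using warping_function_pos[OF g s] by (simp add: field_simps power2_eq_square)
  finally show ?thesis by simp
qed

section \<open>Slices as minimal surfaces\<close>

lemma in_slice_iff:
  assumes "s \<in> {0<..<L}"
  shows "p \<in> slice L s \<longleftrightarrow> (\<exists>w\<in>S2. p = (cos (pi * s / L), sin (pi * s / L) *\<^sub>R w))"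
proof -
  define \<theta> where "\<theta> = pi * s / L"
  have \<theta>: "sin \<theta> > 0" unfolding \<theta>_def using assms by (auto intro!: sin_gt_zero simp: field_simps)
  have n: "(cos \<theta>, z) \<in> S3 \<longleftrightarrow> norm z = sin \<theta>" for z :: "real^3"
  proof -
    have "(cos \<theta>, z) \<in> S3 \<longleftrightarrow> (cos \<theta>)\<^sup>2 + (norm z)\<^sup>2 = 1" by (simp add: norm_Pair)
    also have "\<dots> \<longleftrightarrow> (norm z)\<^sup>2 = (sin \<theta>)\<^sup>2" by (simp add: sin_squared_eq) linarith
    also have "\<dots> \<longleftrightarrow> norm z = sin \<theta>" using \<theta> by (simp add: power2_eq_iff_nonneg)
    finally show ?thesis .
  qed
  show ?thesis
  proof
    assume p: "p \<in> slice L s"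
    obtain z where z: "p = (cos \<theta>, z)" using p by (cases p) (auto simp: slice_def \<theta>_def)
    with p have "(cos \<theta>, z) \<in> S3" unfolding slice_def by blast
    then have nz: "norm z = sin \<theta>" unfolding n .
    show "\<exists>w\<in>S2. p = (cos (pi * s / L), sin (pi * s / L) *\<^sub>R w)"
      unfolding \<theta>_def[symmetric]
    proof (rule bexI)
      show "p = (cos \<theta>, sin \<theta> *\<^sub>R (z /\<^sub>R sin \<theta>))" using \<theta> z by simp
      show "z /\<^sub>R sin \<theta> \<in> S2" using \<theta> nz by simp
    qed
  next
    assume "\<exists>w\<in>S2. p = (cos (pi * s / L), sin (pi * s / L) *\<^sub>R w)"
    then obtain w where w: "norm w = 1" "p = (cos \<theta>, sin \<theta> *\<^sub>R w)" unfolding \<theta>_def by auto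
    then have "(cos \<theta>, sin \<theta> *\<^sub>R w) \<in> S3" unfolding n using \<theta> by simp
    with w(2) show "p \<in> slice L s" unfolding slice_def \<theta>_def[symmetric] by simp
  qed
qed

text \<open>
  Every point of the slice is the centre of one of the rotated charts, because some rotation takes the first
  basis vector to its direction.
\<close>

lemma closed_embedded_slice:
  assumes s: "s \<in> {0<..<L}"
  shows "closed_embedded_surface S3 (slice L s)"
    and "\<And>p. p \<in> slice L s \<Longrightarrow> \<exists>R. orthogonal_transformation R \<and> chart L R (slice_emb s 0) = p"
proof -
  show c: "\<exists>R. orthogonal_transformation R \<and> chart L R (slice_emb s 0) = p" if ps: "p \<in> slice L s" for p
  proof -
    obtain w where w: "w \<in> S2" "p = (cos (pi * s / L), sin (pi * s / L) *\<^sub>R w)"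
      using ps unfolding in_slice_iff[OF s] by blast
    obtain R :: "real^3 \<Rightarrow> real^3" where R: "orthogonal_transformation R" "R (axis 1 1) = w"
      using exists_rotation[OF w(1)] .
    have "sph 0 0 = axis 1 1" by (simp add: sph_alt)
    then have "chart L R (slice_emb s 0) = p" using w R by (simp add: chart_def slice_emb_def polar_def)
    with R show ?thesis by blast
  qed
  have "slice L s = S3 \<inter> fst -` {cos (pi * s / L)}" by (auto simp: slice_def)
  then have "compact (slice L s)"
    by (simp add: closed_Int_compact closed_vimage_fst compact_Int_closed)
  moreover have "slice L s \<noteq> {}"
  proof -
    have "axis 1 1 \<in> S2" by simp
    then have "(cos (pi * s / L), sin (pi * s / L) *\<^sub>R axis 1 1) \<in> slice L s"
      unfolding in_slice_iff[OF s] by blast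
    then show ?thesis by blast
  qed
  moreover have "slice L s \<subseteq> S3" by (auto simp: slice_def)
  moreover have "\<exists>(V :: (real^2) set) \<phi>. local_param (slice L s) V \<phi> \<and> p \<in> \<phi> ` V" if p: "p \<in> slice L s" for p
  proof -
    obtain R where R: "orthogonal_transformation R" "chart L R (slice_emb s 0) = p" using c[OF p] by blast
    have "p \<in> (chart L R \<circ> slice_emb s) ` slice_dom"
      using R(2) by (intro image_eqI[of _ _ 0]) (auto simp: slice_dom_def)
    with local_param_slice_chart[OF R(1) s] show ?thesis by (intro exI conjI)
  qed
  ultimately show "closed_embedded_surface S3 (slice L s)"
    unfolding closed_embedded_surface_def by (intro conjI ballI)
qed

lemma pd_slice_emb: "pd 1 (slice_emb s) = (\<lambda>_. axis 2 1)" "pd 2 (slice_emb s) = (\<lambda>_. axis 3 1)"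
  by (simp_all add: fun_eq_iff pd_def frechet_derivative_slice_emb vec_eq_iff forall_3) (simp_all add: axis_def)

text \<open>
  A normal vector of the slice is radial, so only the radial components \<open>\<Gamma>\<^sup>1\<^bsub>ab\<^esub>\<close> of the second derivatives count.
  They are multiples of \<open>f f'\<close> and vanish at a critical point of \<open>f\<close>.
\<close>

lemma mean_curvature_slice:
  assumes g: "rot_symmetric_sphere L f g" and R: "orthogonal_transformation R" and s: "s \<in> {0<..<L}"
    and crit: "deriv f s = 0" and x: "x \<in> slice_dom"
    and \<nu>: "unit_normal (coord_metric g (chart L R)) (slice_emb s) \<nu> x"
  shows "mean_curvature (coord_metric g (chart L R)) (slice_emb s) \<nu> x = 0"
proof -
  interpret warped_coordinates "chart_dom L" "coord_metric g (chart L R)" f "deriv f" "deriv (deriv f)"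
    by (rule warped_coordinates_chart[OF g R])
  let ?G = "coord_metric g (chart L R)"
  have y: "slice_emb s x \<in> chart_dom L" using s x by (simp add: slice_emb_in_chart_dom)
  define z where "z = ?G (slice_emb s x) *v \<nu>"
  have "pd 1 (slice_emb s) x \<bullet> z = 0" "pd 2 (slice_emb s) x \<bullet> z = 0"
    using \<nu> unfolding unit_normal_def z_def by blast+
  then have z: "z$2 = 0" "z$3 = 0" by (simp_all add: pd_slice_emb inner_axis')
  have "pd a (\<lambda>_. c) x = 0" for a and c :: "real^3" by (simp add: pd_def frechet_derivative_const)
  then have "pd a (pd b (slice_emb s)) x = 0" for a b :: 2
    using exhaust_2[of b] by (auto simp: pd_slice_emb)
  moreover have "christoffel ?G 1 i j (slice_emb s x) = 0" for i j
    unfolding christoffel_G[OF y] using crit by (simp add: warped_christoffel_def slice_emb_def)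
  ultimately have "cov_second_deriv ?G (slice_emb s) a b x $ 1 = 0" for a b
    by (simp add: cov_second_deriv_def)
  then have "cov_second_deriv ?G (slice_emb s) a b x \<bullet> z = 0" for a b
    using z by (simp add: inner_vec_def sum_3)
  then show ?thesis by (simp add: mean_curvature_def z_def)
qed

lemma closed_minimal_slice:
  assumes g: "rot_symmetric_sphere L f g" and s: "s \<in> {0<..<L}" and crit: "deriv f s = 0"
  shows "closed_minimal_surface S3 g (slice L s)"
  unfolding closed_minimal_surface_def
proof (intro conjI ballI)
  show "closed_embedded_surface S3 (slice L s)" by (rule closed_embedded_slice(1)[OF s])
  fix p assume p: "p \<in> slice L s"
  obtain R where R: "orthogonal_transformation R" "chart L R (slice_emb s 0) = p"
    using closed_embedded_slice(2)[OF s p] by (elim exE conjE)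
  have L: "L > 0" using s by auto
  have 0: "0 \<in> slice_dom" by (simp add: slice_dom_def)
  have "slice_emb s ` slice_dom \<subseteq> chart_dom L" using s by (auto simp: slice_emb_in_chart_dom)
  moreover have "smooth_on slice_dom (slice_emb s)"
    by (rule Ck_on_imp_smooth_on[OF open_UNIV smooth_slice_emb]) auto
  ultimately show "\<exists>(W :: (real^3) set) \<psi> (V :: (real^2) set) \<phi>. \<exists>x\<in>V.
        local_param S3 W \<psi> \<and> \<phi> ` V \<subseteq> W \<and> smooth_on V \<phi> \<and> local_param (slice L s) V (\<psi> \<circ> \<phi>) \<and> \<psi> (\<phi> x) = p \<and>
        (\<forall>\<nu>. unit_normal (coord_metric g \<psi>) \<phi> \<nu> x \<longrightarrow>
              mean_curvature (coord_metric g \<psi>) \<phi> \<nu> x = 0)"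
    using local_param_chart[OF R(1) L] local_param_slice_chart[OF R(1) s] R(2) mean_curvature_slice[OF g R(1) s crit 0] 0
    by (intro exI[of _ "chart_dom L"] exI[of _ "chart L R"] exI[of _ slice_dom] exI[of _ "slice_emb s"] bexI[of _ 0] conjI allI impI)
qed

lemma coord_metric_slice:
  assumes g: "rot_symmetric_sphere L f g" and R: "orthogonal_transformation R" and s: "s \<in> {0<..<L}"
    and x: "x \<in> slice_dom"
  shows "det (coord_metric g (chart L R \<circ> slice_emb s) x) = ((f s)\<^sup>2 * cos (x$1))\<^sup>2"
proof -
  note lin = orthogonal_transformation_linear[OF R]
  have y: "slice_emb s x \<in> chart_dom L" using s x by (simp add: slice_emb_in_chart_dom)
  have "frechet_derivative (chart L R \<circ> slice_emb s) (at x)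
      = frechet_derivative (chart L R) (at (slice_emb s x)) \<circ> frechet_derivative (slice_emb s) (at x)"
    by (rule frechet_derivative_compose[OF differentiableI[OF has_derivative_slice_emb] differentiableI[OF has_derivative_chart[OF lin]]])
  then have "pd a (chart L R \<circ> slice_emb s) x = frechet_derivative (chart L R) (at (slice_emb s x)) (pd a (slice_emb s) x)" for a
    by (simp add: pd_def)
  then have p: "pd 1 (chart L R \<circ> slice_emb s) x = pd 2 (chart L R) (slice_emb s x)"
    "pd 2 (chart L R \<circ> slice_emb s) x = pd 3 (chart L R) (slice_emb s x)"
    by (simp_all add: pd_slice_emb) (simp_all add: pd_def)
  have "g (chart L R (slice_emb s x)) (pd i (chart L R) (slice_emb s x)) (pd j (chart L R) (slice_emb s x))
     = warped_matrix f (slice_emb s x) $ i $ j" for i j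
    using coord_metric_chart[OF g R y] by (simp add: coord_metric_def vec_eq_iff)
  then show ?thesis
    by (simp add: det_2 coord_metric_def p warped_matrix_def slice_emb_def power2_eq_square)
qed

lemma finite_half_sphere_cover:
  obtains n :: nat and c :: "nat \<Rightarrow> real^3" where "\<And>i. i < n \<Longrightarrow> c i \<in> S2" "\<And>w. w \<in> S2 \<Longrightarrow> \<exists>i<n. w \<bullet> c i > 0"
proof -
  have "open {w :: real^3. w \<bullet> c > 0}" for c by (intro open_Collect_less continuous_intros)
  moreover have "S2 \<subseteq> (\<Union>c\<in>S2. {w. w \<bullet> c > 0})"
  proof
    fix w :: "real^3" assume "w \<in> S2"
    moreover from this have "w \<bullet> w > 0" by (auto simp: norm_eq_sqrt_inner)
    ultimately show "w \<in> (\<Union>c\<in>S2. {w. w \<bullet> c > 0})" by blast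
  qed
  ultimately obtain T where T: "T \<subseteq> S2" "finite T" "S2 \<subseteq> (\<Union>c\<in>T. {w. w \<bullet> c > 0})"
    using compactE_image[OF compact_sphere, of S2 "\<lambda>c. {w. w \<bullet> c > 0}" 0 1] by blast
  obtain c :: "nat \<Rightarrow> real^3" and n where c: "T = c ` {i. i < n}"
    using finite_imp_nat_seg_image_inj_on[OF T(2)] by blast
  show thesis
    by (rule that[of n c]) (use T c in auto)
qed

text \<open>
  The area element in each chart is \<open>f(s)\<^sup>2\<close> times a function bounded by \<open>1\<close> on a bounded domain.
  A cover by finitely many half spheres, independent of the metric, is made disjoint by removing from
  each piece the pieces before it.  Only the
  factor \<open>f(s)\<^sup>2\<close> matters: it keeps minimal slices from being too thin.
\<close>

lemma slice_area_bound:
  obtains C :: real where "C \<ge> 0"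
    "\<And>L f g s. rot_symmetric_sphere L f g \<Longrightarrow> s \<in> {0<..<L} \<Longrightarrow> surface_area g (slice L s) \<le> ennreal (C * (f s)\<^sup>2)"
proof -
  obtain n :: nat and c :: "nat \<Rightarrow> real^3"
    where c: "\<And>i. i < n \<Longrightarrow> c i \<in> S2" "\<And>w. w \<in> S2 \<Longrightarrow> \<exists>i<n. w \<bullet> c i > 0"
    using finite_half_sphere_cover by blast
  have "\<forall>i. \<exists>R :: real^3 \<Rightarrow> real^3. i < n \<longrightarrow> orthogonal_transformation R \<and> R (axis 1 1) = c i"
    using exists_rotation c(1) by metis
  then obtain R :: "nat \<Rightarrow> real^3 \<Rightarrow> real^3" where R: "\<And>i. i < n \<Longrightarrow> orthogonal_transformation (R i)" "\<And>i. i < n \<Longrightarrow> R i (axis 1 1) = c i"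
    by metis
  have "slice_dom \<subseteq> cbox (vector [-(pi/2), -(pi/2)]) (vector [pi/2, pi/2])"
    by (auto simp: slice_dom_def mem_box_cart forall_2)
  then have "bounded slice_dom" using bounded_cbox bounded_subset by blast
  then have fin: "emeasure lborel slice_dom < \<infinity>" by (rule emeasure_bounded_finite)
  define m where "m = measure lborel slice_dom"
  have m: "emeasure lborel slice_dom = ennreal m"
    unfolding m_def using fin by (intro emeasure_eq_ennreal_measure) auto
  have m0: "m \<ge> 0" by (simp add: m_def)
  have sd: "slice_dom \<in> sets borel" using open_slice_dom by simp
  show thesis
  proof (rule that[of "n * m"])
    show "0 \<le> n * m" by (simp add: m_def)
    fix L f g s assume g: "rot_symmetric_sphere L f g" and s: "s \<in> {0<..<L}"
    define \<phi> where "\<phi> = (\<lambda>i. chart L (R i) \<circ> slice_emb s)"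
    define B where "B = (\<lambda>i. {x\<in>slice_dom. \<forall>j<i. snd (\<phi> i x) \<bullet> c j \<le> 0})"
    have im: "\<phi> i ` slice_dom = {p\<in>slice L s. snd p \<bullet> c i > 0}" if "i < n" for i
      using slice_chart_image(1)[OF R(1)[OF that] s] R(2)[OF that] by (simp add: \<phi>_def)
    have lp: "local_param (slice L s) slice_dom (\<phi> i)" if "i < n" for i
      unfolding \<phi>_def by (rule local_param_slice_chart[OF R(1)[OF that] s])
    have B: "B i \<in> sets borel" if "i < n" for i
    proof -
      have "continuous_on UNIV (\<phi> i)"
        using smooth_chart_slice[OF orthogonal_transformation_linear[OF R(1)[OF that]], of 0 L s] by (simp add: \<phi>_def)
      then have "closed {x. snd (\<phi> i x) \<bullet> c j \<le> 0}" for j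
        by (intro closed_Collect_le continuous_intros)
      then have "closed (\<Inter>j\<in>{..<i}. {x. snd (\<phi> i x) \<bullet> c j \<le> 0})" by blast
      moreover have "B i = slice_dom \<inter> (\<Inter>j\<in>{..<i}. {x. snd (\<phi> i x) \<bullet> c j \<le> 0})" by (auto simp: B_def)
      ultimately show ?thesis using sd by auto
    qed
    have disj: "\<phi> i ` B i \<inter> \<phi> j ` B j = {}" if "i < j" "j < n" for i j
    proof (rule ccontr)
      assume "\<phi> i ` B i \<inter> \<phi> j ` B j \<noteq> {}"
      then obtain p where "p \<in> \<phi> i ` B i" "p \<in> \<phi> j ` B j" by blast
      then obtain x y where xy: "x \<in> B i" "y \<in> B j" "\<phi> i x = \<phi> j y" by (elim imageE) simp
      have "x \<in> slice_dom" using xy by (simp add: B_def)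
      then have "snd (\<phi> i x) \<bullet> c i > 0" using im[of i] that by auto
      moreover have "snd (\<phi> j y) \<bullet> c i \<le> 0" using xy that by (simp add: B_def)
      ultimately show False using xy by simp
    qed
    have un: "(\<Union>i<n. \<phi> i ` B i) = slice L s"
    proof
      show "(\<Union>i<n. \<phi> i ` B i) \<subseteq> slice L s" using im unfolding B_def by blast
      show "slice L s \<subseteq> (\<Union>i<n. \<phi> i ` B i)"
      proof
        fix p assume p: "p \<in> slice L s"
        obtain w where w: "w \<in> S2" "p = (cos (pi * s / L), sin (pi * s / L) *\<^sub>R w)"
          using p unfolding in_slice_iff[OF s] by blast
        have "sin (pi * s / L) > 0" using s by (auto intro!: sin_gt_zero simp: field_simps)
        then have ex: "\<exists>i. i < n \<and> snd p \<bullet> c i > 0" using c(2)[OF w(1)] w(2) by auto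
        \<comment> \<open>the point belongs to the piece of the first half sphere that contains it\<close>
        define i where "i = (LEAST i. i < n \<and> snd p \<bullet> c i > 0)"
        have i: "i < n" "snd p \<bullet> c i > 0" using LeastI_ex[OF ex] by (simp_all add: i_def)
        have l: "snd p \<bullet> c j \<le> 0" if "j < i" for j
          using not_less_Least[OF that[unfolded i_def]] that i(1) by auto
        have "p \<in> \<phi> i ` slice_dom" unfolding im[OF i(1)] using p i(2) by simp
        then obtain x where x: "x \<in> slice_dom" "p = \<phi> i x" by (elim imageE)
        have "x \<in> B i" using x(1) l unfolding B_def x(2) by simp
        then have "p \<in> \<phi> i ` B i" using x(2) by (rule image_eqI[rotated])
        then show "p \<in> (\<Union>i<n. \<phi> i ` B i)" using i(1) by blast
      qed
    qed
    have pc: "(\<integral>\<^sup>+x\<in>B i. ennreal (sqrt (det (coord_metric g (\<phi> i) x))) \<partial>lborel) \<le> ennreal ((f s)\<^sup>2 * m)" if "i < n" for i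
    proof -
      have "(\<integral>\<^sup>+x\<in>B i. ennreal (sqrt (det (coord_metric g (\<phi> i) x))) \<partial>lborel)
          \<le> (\<integral>\<^sup>+x. ennreal ((f s)\<^sup>2) * indicator slice_dom x \<partial>lborel)"
      proof (rule nn_integral_mono)
        fix x
        show "ennreal (sqrt (det (coord_metric g (\<phi> i) x))) * indicator (B i) x \<le> ennreal ((f s)\<^sup>2) * indicator slice_dom x"
        proof (cases "x \<in> B i")
          case True
          then have x: "x \<in> slice_dom" by (simp add: B_def)
          have "sqrt (det (coord_metric g (\<phi> i) x)) = (f s)\<^sup>2 * \<bar>cos (x$1)\<bar>"
            unfolding \<phi>_def coord_metric_slice[OF g R(1)[OF that] s x] by (simp add: abs_mult)
          also have "\<dots> \<le> (f s)\<^sup>2 * 1" by (intro mult_left_mono) auto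
          finally show ?thesis using x True by (simp add: ennreal_leI)
        qed simp
      qed
      also have "\<dots> = ennreal ((f s)\<^sup>2 * m)"
        using sd m m0 by (simp add: nn_integral_cmult_indicator ennreal_mult)
      finally show ?thesis .
    qed
    have "surface_area g (slice L s) \<le> (\<Sum>i<n. \<integral>\<^sup>+x\<in>B i. ennreal (sqrt (det (coord_metric g (\<phi> i) x))) \<partial>lborel)"
      unfolding surface_area_def
    proof (rule Inf_lower, rule CollectI, rule exI[of _ n], rule exI[of _ "\<lambda>_. slice_dom"],
        rule exI[of _ \<phi>], rule exI[of _ B], intro conjI allI impI refl)
      show "disjoint_family_on (\<lambda>i. \<phi> i ` B i) {..<n}"
        unfolding disjoint_family_on_def using disj
      proof (intro ballI impI)
        fix i j assume "i \<in> {..<n}" "j \<in> {..<n}" "i \<noteq> j"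
        then show "\<phi> i ` B i \<inter> \<phi> j ` B j = {}"
          using disj[of i j] disj[of j i] by (cases i j rule: linorder_cases) (simp_all add: Int_commute)
      qed
      show "B i \<subseteq> slice_dom" for i by (auto simp: B_def)
          show "local_param (slice L s) slice_dom (\<phi> i)" "B i \<in> sets borel" if "i < n" for i
        using lp[OF that] B[OF that] .
    qed (rule un)
    also have "\<dots> \<le> (\<Sum>i<n. ennreal ((f s)\<^sup>2 * m))" by (rule sum_mono) (rule pc, simp)
    also have "\<dots> = ennreal (n * m * (f s)\<^sup>2)"
      using m0 by (simp add: sum_ennreal mult_ac del: sum_constant) (simp add: mult_ac)
    finally show "surface_area g (slice L s) \<le> ennreal (n * m * (f s)\<^sup>2)" .
  qed
qed

lemma neck_radius_bound:
  assumes "A > 0"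
  obtains \<epsilon> :: real where "\<epsilon> > 0"
    "\<And>L f g s. rot_symmetric_sphere L f g \<Longrightarrow> MinA S3 g \<ge> ennreal A \<Longrightarrow> s \<in> {0<..<L} \<Longrightarrow> deriv f s = 0 \<Longrightarrow> f s \<ge> \<epsilon>"
proof -
  obtain C :: real where C: "C \<ge> 0"
    "\<And>L f g s. rot_symmetric_sphere L f g \<Longrightarrow> s \<in> {0<..<L} \<Longrightarrow> surface_area g (slice L s) \<le> ennreal (C * (f s)\<^sup>2)"
    using slice_area_bound by blast
  show thesis
  proof (rule that[of "sqrt (A / (C + 1))"])
    show "sqrt (A / (C + 1)) > 0" using assms C(1) by simp
    fix L f g s
    assume g: "rot_symmetric_sphere L f g" and M: "MinA S3 g \<ge> ennreal A" and s: "s \<in> {0<..<L}" and d: "deriv f s = 0"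
    have "ennreal A \<le> surface_area g (slice L s)"
    proof (rule order_trans[OF M])
      show "MinA S3 g \<le> surface_area g (slice L s)"
        unfolding MinA_def by (rule INF_lower) (simp add: closed_minimal_slice[OF g s d])
    qed
    also have "\<dots> \<le> ennreal (C * (f s)\<^sup>2)" by (rule C(2)[OF g s])
    finally have "A \<le> C * (f s)\<^sup>2" using C(1) by (simp add: ennreal_le_iff)
    also have "\<dots> \<le> (C + 1) * (f s)\<^sup>2" by (simp add: mult_right_mono)
    finally have "A / (C + 1) \<le> (f s)\<^sup>2" using C(1) by (simp add: field_simps)
    then show "sqrt (A / (C + 1)) \<le> f s"
      using warping_function_pos[OF g s] by (simp add: real_le_lsqrt)
  qed
qed

section \<open>The distance between the poles\<close>

text \<open>
  The radial component of a tangent vector \<open>(a, b)\<close> is \<open>- (L / \<pi>) a / sin \<theta>\<close>, where the axial coordinate is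
  \<open>\<tau> = cos \<theta>\<close>; its square is one of the two nonnegative summands of the metric.
\<close>

lemma radial_speed_bound:
  assumes g: "rot_symmetric_sphere L f g"
    and p: "(\<tau>, z) \<in> S3" and \<tau>: "\<bar>\<tau>\<bar> < 1" and tan: "\<tau> * a + z \<bullet> b = 0"
  shows "L / pi * \<bar>a\<bar> / sqrt (1 - \<tau>\<^sup>2) \<le> sqrt (g (\<tau>, z) (a, b) (a, b))"
proof -
  have L: "L > 0" using g by (simp add: rot_symmetric_sphere_def)
  define N where "N = sqrt (1 - \<tau>\<^sup>2)"
  have "\<tau>\<^sup>2 < 1" using \<tau> by (simp add: abs_square_less_1)
  then have N: "N > 0" by (simp add: N_def)
  define s where "s = L / pi * arccos \<tau>"
  have \<theta>: "pi * s / L = arccos \<tau>" using L by (simp add: s_def)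
  have s: "s \<in> {0<..<L}"
    using L \<tau> arccos_lt_bounded[of \<tau>] by (auto simp: s_def field_simps abs_less_iff)
  have sc: "sin (pi * s / L) = N" "cos (pi * s / L) = \<tau>"
    using \<tau> unfolding \<theta> by (auto simp: N_def sin_arccos abs_less_iff)
  have "\<tau>\<^sup>2 + (norm z)\<^sup>2 = 1" using p by (simp add: norm_Pair)
  then have "norm z = N" unfolding N_def by (metis add_diff_cancel_left' norm_ge_zero real_sqrt_unique)
  define w where "w = z /\<^sub>R N"
  have w: "w \<in> S2" "z = N *\<^sub>R w" using N \<open>norm z = N\<close> by (simp_all add: w_def)
  then have ww: "w \<bullet> w = 1" by (simp add: norm_eq_sqrt_inner)
  define c where "c = - (L / pi * a / N)"
  define v where "v = (b - (\<tau> * (pi / L) * c) *\<^sub>R w) /\<^sub>R N"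
  have "N * (b \<bullet> w) = - (\<tau> * a)" using tan w(2) by (simp add: inner_commute)
  then have "b \<bullet> w = \<tau> * (pi / L) * c" using N L by (simp add: c_def field_simps)
  then have vw: "v \<bullet> w = 0" by (simp add: v_def inner_diff_left ww)
  have "polar L (s, w) = (\<tau>, z)" unfolding polar_def by (simp add: sc w(2))
  moreover have "frechet_derivative (polar L) (at (s, w)) (c, v) = (a, b)"
    unfolding frechet_derivative_polar sc using N L by (simp add: c_def v_def)
  ultimately have "g (\<tau>, z) (a, b) (a, b) = c * c + (f s)\<^sup>2 * (v \<bullet> v)"
    using polar_metric[OF g s w(1) vw vw, of c c] by simp
  then have "c\<^sup>2 \<le> g (\<tau>, z) (a, b) (a, b)" by (simp add: power2_eq_square)
  then have "\<bar>c\<bar> \<le> sqrt (g (\<tau>, z) (a, b) (a, b))" by (metis real_sqrt_abs real_sqrt_le_iff)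
  moreover have "\<bar>c\<bar> = L / pi * \<bar>a\<bar> / N" using L N by (simp add: c_def abs_mult)
  ultimately show ?thesis by (simp add: N_def)
qed

lemma sphere_curve_tangent:
  fixes \<gamma> :: "real \<Rightarrow> 'a::real_inner"
  assumes "(\<gamma> has_vector_derivative v) (at t)" "t \<in> {0<..<1}" "\<And>u. u \<in> {0..1} \<Longrightarrow> norm (\<gamma> u) = 1"
  shows "\<gamma> t \<bullet> v = 0"
proof -
  have "((\<lambda>t. \<gamma> t \<bullet> \<gamma> t) has_derivative (\<lambda>h. \<gamma> t \<bullet> (h *\<^sub>R v) + (h *\<^sub>R v) \<bullet> \<gamma> t)) (at t)"
    using assms(1) unfolding has_vector_derivative_def by (intro has_derivative_inner)
  then have "((\<lambda>t. \<gamma> t \<bullet> \<gamma> t) has_real_derivative 2 * (\<gamma> t \<bullet> v)) (at t)"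
    unfolding has_field_derivative_def
    by (rule has_derivative_eq_rhs) (auto simp: inner_commute algebra_simps)
  moreover have "\<forall>y. \<bar>t - y\<bar> < min t (1 - t) \<longrightarrow> \<gamma> t \<bullet> \<gamma> t = \<gamma> y \<bullet> \<gamma> y"
  proof (intro allI impI)
    fix y assume "\<bar>t - y\<bar> < min t (1 - t)"
    then have "y \<in> {0..1}" "t \<in> {0..1}" by (auto simp: abs_less_iff)
    then show "\<gamma> t \<bullet> \<gamma> t = \<gamma> y \<bullet> \<gamma> y" using assms(3) by (metis norm_eq)
  qed
  ultimately have "2 * (\<gamma> t \<bullet> v) = 0"
    using assms(2) by (intro DERIV_local_const[of _ _ t "min t (1 - t)"]) auto
  then show ?thesis by simp
qed

text \<open>
  The distance from the pole is \<open>(L / \<pi>) arccos \<tau>\<close> in the axial coordinate \<open>\<tau>\<close>, which is not differentiable at the poles.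
  It is replaced by \<open>(L / \<pi>) arcsin (q \<tau>)\<close> with \<open>q < 1\<close>, which is smooth on the whole sphere, varies no
  faster up to sign, and still changes by a prescribed amount \<open>l < L\<close> from pole to pole for a suitable \<open>q\<close>.  The derivative of
  the path need not be bounded near its finitely many corners; the integral of the rate of
  change is either infinite or bounds the total change, and both cases give the estimate.
\<close>

lemma path_length_between_poles:
  assumes g: "rot_symmetric_sphere L f g" and \<gamma>: "valid_path \<gamma>" "path_image \<gamma> \<subseteq> S3"
    "pathstart \<gamma> = (1, 0)" "pathfinish \<gamma> = (-1, 0)" and l: "0 < l" "l < L"
  shows "ennreal l \<le> path_length g \<gamma>"
proof -
  have L: "L > 0" using g by (simp add: rot_symmetric_sphere_def)
  \<comment> \<open>this value of \<open>q\<close> makes \<open>(L / \<pi>) arcsin (q \<tau>)\<close> equal to \<open>l / 2\<close> and \<open>- l / 2\<close> at the poles\<close>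
  define q where "q = sin (pi * l / (2 * L))"
  have a: "0 < pi * l / (2 * L)" "pi * l / (2 * L) < pi / 2" using l by (auto simp: field_simps)
  have q: "0 < q" "q < 1"
  proof -
    show "0 < q" unfolding q_def using a by (intro sin_gt_zero) auto
    have "sin (pi * l / (2 * L)) < sin (pi / 2)" using a by (intro sin_monotone_2pi) auto
    then show "q < 1" by (simp add: q_def)
  qed
  have asq: "arcsin q = pi * l / (2 * L)" unfolding q_def using a by (intro arcsin_sin) auto
  obtain S where S: "finite S" "\<gamma> C1_differentiable_on ({0..1} - S)" and c\<gamma>: "continuous_on {0..1} \<gamma>"
    using \<gamma>(1) unfolding valid_path_def piecewise_C1_differentiable_on_def by blast
  obtain D where D: "\<forall>t\<in>{0..1}-S. (\<gamma> has_vector_derivative D t) (at t)" "continuous_on ({0..1}-S) D"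
    using S(2) unfolding C1_differentiable_on_def by blast
  have S3: "norm (\<gamma> t) = 1" if "t \<in> {0..1}" for t
    using \<gamma>(2) that unfolding path_image_def by fastforce
  have \<tau>1: "\<bar>fst (\<gamma> t)\<bar> \<le> 1" if "t \<in> {0..1}" for t
    using norm_fst_le[of "fst (\<gamma> t)" "snd (\<gamma> t)"] S3[OF that] by simp
  have qt: "\<bar>q * fst (\<gamma> t)\<bar> < 1" if "t \<in> {0..1}" for t
  proof -
    have "q * \<bar>fst (\<gamma> t)\<bar> \<le> q * 1" using \<tau>1[OF that] q by (intro mult_left_mono) auto
    also have "\<dots> < 1" using q by simp
    finally show ?thesis using q by (simp only: abs_mult abs_of_pos)
  qed
  define u where "u t = L / pi * arcsin (q * fst (\<gamma> t))" for t
  define k where "k t = L / pi * (q * fst (D t) / sqrt (1 - (q * fst (\<gamma> t))\<^sup>2))" for t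
  define E where "E = {0<..<1} - S"
  have du: "(u has_vector_derivative k t) (at t)" if "t \<in> E" for t
  proof -
    have t: "t \<in> {0..1} - S" using that by (auto simp: E_def)
    have "((\<lambda>t. fst (\<gamma> t)) has_derivative (\<lambda>h. fst (h *\<^sub>R D t))) (at t)"
      using D(1) t unfolding has_vector_derivative_def by (intro has_derivative_fst) blast
    then have "((\<lambda>t. fst (\<gamma> t)) has_real_derivative fst (D t)) (at t)"
      by (simp add: has_field_derivative_def mult_commute_abs)
    moreover have "-1 < q * fst (\<gamma> t)" "q * fst (\<gamma> t) < 1" using qt[of t] t by (auto simp: abs_less_iff)
    ultimately have "(u has_real_derivative k t) (at t)"
      unfolding u_def k_def by (auto intro!: derivative_eq_intros simp: divide_inverse)
    then show ?thesis by (simp add: has_real_derivative_iff_has_vector_derivative)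
  qed
  have sq: "(q * fst (\<gamma> t))\<^sup>2 < 1" if "t \<in> {0..1}" for t
    using qt[OF that] by (simp add: abs_square_less_1)
  have cu: "continuous_on {0..1} u"
    unfolding u_def using qt by (intro continuous_intros c\<gamma>) (auto simp: abs_less_iff less_imp_le)
  have ck: "continuous_on E k"
    unfolding k_def
  proof (intro continuous_intros)
    show "continuous_on E D" "continuous_on E \<gamma>"
      by (rule continuous_on_subset[OF D(2)] continuous_on_subset[OF c\<gamma>]; force simp: E_def)+
    show "\<forall>t\<in>E. sqrt (1 - (q * fst (\<gamma> t))\<^sup>2) \<noteq> 0"
    proof
      fix t assume "t \<in> E"
      then have "t \<in> {0..1}" by (simp add: E_def)
      from sq[OF this] show "sqrt (1 - (q * fst (\<gamma> t))\<^sup>2) \<noteq> 0" by simp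
    qed
  qed
  have "(k has_integral (u 1 - u 0)) {0..1}"
    by (rule fundamental_theorem_of_calculus_interior_strong[OF S(1)]) (use du cu in \<open>auto simp: E_def\<close>)
  moreover have "u 1 - u 0 = - l"
    using \<gamma>(3,4) L q arcsin_minus[of q] by (simp add: u_def pathstart_def pathfinish_def asq)
  ultimately have "(k has_integral - l) {0..1}" by simp
  then have "((\<lambda>t. indicator E t *\<^sub>R k t) has_integral - l) {0..1}"
    by (rule has_integral_spike_finite[of "insert 0 (insert 1 S)", rotated 2]) (auto simp: S E_def)
  then have "((\<lambda>t. if t \<in> {0..1} then indicator E t *\<^sub>R k t else 0) has_integral - l) UNIV"
    by (simp only: has_integral_restrict_UNIV)
  moreover have "(\<lambda>t. if t \<in> {0..1} then indicator E t *\<^sub>R k t else 0) = (\<lambda>t. indicator E t *\<^sub>R k t)"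
    by (rule ext) (auto simp: E_def indicator_def)
  ultimately have HI: "((\<lambda>t. indicator E t *\<^sub>R k t) has_integral - l) UNIV" by (simp only:)
  have Eb: "E \<in> sets borel" unfolding E_def using S(1) by (intro borel_open open_Diff finite_imp_closed) auto
  have mk: "(\<lambda>t. indicator E t *\<^sub>R k t) \<in> borel_measurable lborel"
    using borel_measurable_continuous_on_indicator[OF Eb ck] by simp
  have "ennreal l \<le> (\<integral>\<^sup>+t. ennreal (norm (indicator E t *\<^sub>R k t)) \<partial>lborel)"
  proof (cases "(\<integral>\<^sup>+t. ennreal (norm (indicator E t *\<^sub>R k t)) \<partial>lborel) < \<infinity>")
    case True
    then have int: "integrable lborel (\<lambda>t. indicator E t *\<^sub>R k t)" using mk by (intro integrableI_bounded)
    from has_integral_unique[OF has_integral_integral_lborel[OF int] HI]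
    have "(LINT t|lborel. indicator E t *\<^sub>R k t) = - l" .
    with integral_norm_bound_ennreal[OF int] show ?thesis using l by simp
  next
    case False
    then show ?thesis by (simp add: not_less top_unique)
  qed
  also have "\<dots> \<le> path_length g \<gamma>"
    unfolding path_length_def
  proof (rule nn_integral_mono)
    fix t
    show "ennreal (norm (indicator E t *\<^sub>R k t))
       \<le> ennreal (sqrt (g (\<gamma> t) (vector_derivative \<gamma> (at t)) (vector_derivative \<gamma> (at t)))) * indicator {0..1} t"
    proof (cases "t \<in> E")
      case True
      then have t: "t \<in> {0..1} - S" "t \<in> {0<..<1}" "t \<in> {0..1}" by (auto simp: E_def)
      obtain \<tau> z where p: "\<gamma> t = (\<tau>, z)" by (cases "\<gamma> t")
      obtain a b where d: "D t = (a, b)" by (cases "D t")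
      have vd: "vector_derivative \<gamma> (at t) = (a, b)"
        by (rule vector_derivative_at[OF bspec[OF D(1) t(1)], unfolded d])
      have "\<gamma> t \<bullet> D t = 0"
        by (rule sphere_curve_tangent[OF bspec[OF D(1) t(1)] t(2) S3])
      then have tan: "\<tau> * a + z \<bullet> b = 0" by (simp add: p d)
      have pS: "(\<tau>, z) \<in> S3" using S3[OF t(3)] p by simp
      have \<tau>: "\<bar>\<tau>\<bar> \<le> 1" using \<tau>1[OF t(3)] p by simp
      have "\<bar>k t\<bar> \<le> sqrt (g (\<tau>, z) (a, b) (a, b))" if "a \<noteq> 0"
      proof -
        \<comment> \<open>at a pole every tangent vector is orthogonal to the axis, so a nonzero \<open>a\<close> excludes the poles\<close>
        have "\<bar>\<tau>\<bar> \<noteq> 1"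
        proof
          assume \<tau>1: "\<bar>\<tau>\<bar> = 1"
          have "\<tau>\<^sup>2 + (norm z)\<^sup>2 = 1" using pS by (simp add: norm_Pair)
          then have "z = 0" using \<tau>1 by (metis abs_1 add_cancel_right_right norm_eq_zero power2_abs power_one zero_eq_power2)
          then show False using tan that \<tau>1 by auto
        qed
        then have lt: "\<bar>\<tau>\<bar> < 1" using \<tau> by simp
        then have \<tau>2: "\<tau>\<^sup>2 < 1" by (simp add: abs_square_less_1)
        have q2: "q\<^sup>2 \<le> 1" using q by (simp add: power_le_one)
        have "q * sqrt (1 - \<tau>\<^sup>2) = sqrt (q\<^sup>2 * (1 - \<tau>\<^sup>2))" using q by (simp add: real_sqrt_mult)
        also have "\<dots> \<le> sqrt (1 - (q * \<tau>)\<^sup>2)" using q2 by (simp add: power_mult_distrib algebra_simps)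
        finally have "q / sqrt (1 - (q * \<tau>)\<^sup>2) \<le> 1 / sqrt (1 - \<tau>\<^sup>2)"
          using \<tau>2 sq[OF t(3)] p by (simp add: field_simps)
        then have "L / pi * \<bar>a\<bar> * (q / sqrt (1 - (q * \<tau>)\<^sup>2)) \<le> L / pi * \<bar>a\<bar> * (1 / sqrt (1 - \<tau>\<^sup>2))"
          using L by (intro mult_left_mono) auto
        moreover have "\<bar>k t\<bar> = L / pi * \<bar>a\<bar> * (q / sqrt (1 - (q * \<tau>)\<^sup>2))"
          using L q sq[OF t(3)] by (simp add: k_def p d abs_mult)
        ultimately show ?thesis using radial_speed_bound[OF g pS lt tan] by simp
      qed
      moreover have "k t = 0" if "a = 0" using that by (simp add: k_def d)
      ultimately have "ennreal \<bar>k t\<bar> \<le> ennreal (sqrt (g (\<tau>, z) (a, b) (a, b)))"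
        by (cases "a = 0") (auto intro: ennreal_leI)
      then show ?thesis using True t by (simp add: p vd)
    qed simp
  qed
  finally show ?thesis .
qed

lemma diameter_ge_pole_distance:
  assumes g: "rot_symmetric_sphere L f g"
  shows "ennreal L \<le> riem_diam S3 g"
proof -
  have L: "L > 0" using g by (simp add: rot_symmetric_sphere_def)
  have "ennreal L \<le> riem_dist S3 g (1, 0) (-1, 0)"
    unfolding riem_dist_def
  proof (rule Inf_greatest, elim imageE CollectE conjE, simp only:)
    fix \<gamma> assume \<gamma>: "valid_path \<gamma>" "path_image \<gamma> \<subseteq> S3" "pathstart \<gamma> = (1, 0)" "pathfinish \<gamma> = (-1, 0)"
    show "ennreal L \<le> path_length g \<gamma>"
    proof (cases "path_length g \<gamma>")
      case (real P)
      have "L \<le> P"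
      proof (rule dense_le_bounded[OF L])
        fix l assume "0 < l" "l < L"
        from path_length_between_poles[OF g \<gamma> this] show "l \<le> P" using real by simp
      qed
      then show ?thesis using real by (simp add: ennreal_leI)
    qed simp
  qed
  also have "\<dots> \<le> riem_diam S3 g"
    unfolding riem_diam_def
    by (rule SUP_upper2[of "(1, 0)"], simp add: norm_Pair, rule SUP_upper2[of "(-1, 0)"], simp_all add: norm_Pair)
  finally show ?thesis .
qed

section \<open>Positivity of the limit between its ends\<close>

lemma extend_zero_properties:
  assumes g: "rot_symmetric_sphere L f g"
  shows "continuous_on {0..} (extend_zero L f)" "extend_zero L f s \<ge> 0" "extend_zero L f s > 0 \<longleftrightarrow> s \<in> {0<..<L}"
    "s \<in> {0<..<L} \<Longrightarrow> extend_zero L f s = f s"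
proof -
  have L: "L > 0" and f0: "f 0 = 0" "f L = 0" and fpos: "\<And>s. s \<in> {0<..<L} \<Longrightarrow> f s > 0" and sm: "smooth_on {0..L} f"
    using g unfolding rot_symmetric_sphere_def by blast+
  have "continuous_on {0..L} (extend_zero L f)"
    using smooth_on_continuous[OF sm] by (rule continuous_on_eq) (simp add: extend_zero_def)
  moreover have "continuous_on {L..} (extend_zero L f)"
    by (rule continuous_on_eq[OF continuous_on_const[of _ 0]]) (use f0 in \<open>auto simp: extend_zero_def\<close>)
  ultimately have "continuous_on ({0..L} \<union> {L..}) (extend_zero L f)" by (intro continuous_on_closed_Un) auto
  moreover have "{0..L} \<union> {L..} = {0..}" using L by auto
  ultimately show "continuous_on {0..} (extend_zero L f)" by simp
  have cases: "s \<notin> {0..L} \<or> s = 0 \<or> s = L \<or> s \<in> {0<..<L}" by auto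
  show "extend_zero L f s \<ge> 0" "extend_zero L f s > 0 \<longleftrightarrow> s \<in> {0<..<L}"
    using cases fpos[of s] f0 by (auto simp: extend_zero_def less_imp_le)
  show "s \<in> {0<..<L} \<Longrightarrow> extend_zero L f s = f s" by (simp add: extend_zero_def)
qed

text \<open>
  A minimum of \<open>f\<close> on \<open>[p,q]\<close> cannot sit at an end point, where \<open>f\<close> exceeds \<open>f s\<close>.
\<close>

lemma interior_minimum_below:
  assumes g: "rot_symmetric_sphere L f g" and pq: "0 < p" "p < s" "s < q" "q < L" and less: "f s < f p" "f s < f q"
  obtains m where "m \<in> {0<..<L}" "deriv f m = 0" "f m \<le> f s"
proof -
  have "continuous_on {p..q} f"
    by (rule continuous_at_imp_continuous_on) (use pq warping_function_derivatives(1)[OF g, THEN DERIV_isCont] in auto)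
  then obtain m where m: "m \<in> {p..q}" "\<And>x. x \<in> {p..q} \<Longrightarrow> f m \<le> f x"
    using continuous_attains_inf[of "{p..q}" f] pq by auto
  have ms: "f m \<le> f s" using m(2)[of s] pq by auto
  then have "m \<noteq> p" "m \<noteq> q" using less by auto
  then have mpq: "p < m" "m < q" using m(1) by auto
  then have mL: "m \<in> {0<..<L}" using pq by auto
  have "deriv f m = 0"
  proof (rule DERIV_local_min[OF warping_function_derivatives(1)[OF g mL]])
    show "0 < min (m - p) (q - m)" using mpq by simp
    show "\<forall>y. \<bar>m - y\<bar> < min (m - p) (q - m) \<longrightarrow> f m \<le> f y" by (auto intro!: m(2))
  qed
  then show thesis by (rule that[OF mL _ ms])
qed

text \<open>
  By definition of the ends, a point between them has points with nonzero limit on both sides.  If the limit vanished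
  at the point itself, the functions would pinch: late in the sequence there would be an interior critical point
  with a value below any given positive bound.
\<close>

lemma limit_interior:
  fixes L :: "nat \<Rightarrow> real"
  assumes g: "\<And>j. rot_symmetric_sphere (L j) (f j) (g j)" and LD: "\<And>j. L j \<le> D" and D: "D > 0"
    and neck: "\<And>j s. s \<in> {0<..<L j} \<Longrightarrow> deriv (f j) s = 0 \<Longrightarrow> f j s \<ge> \<epsilon>" and \<epsilon>: "\<epsilon> > 0"
    and lim: "uniform_limit {0..D} (\<lambda>j. extend_zero (L j) (f j)) f_lim sequentially"
    and s: "s \<in> {a_end D f_lim<..<b_end D f_lim}"
  shows "s \<in> {0<..<D}" "f_lim s > 0"
proof -
  have tend: "(\<lambda>j. extend_zero (L j) (f j) t) \<longlonglongrightarrow> f_lim t" if "t \<in> {0..D}" for t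
    using lim that by (rule tendsto_uniform_limitI)
  have nonneg: "f_lim t \<ge> 0" if "t \<in> {0..D}" for t
    by (rule LIMSEQ_le_const[OF tend[OF that]]) (use extend_zero_properties(2)[OF g] in auto)
  have zero: "f_lim t = 0" if "t \<in> {0..D}" "\<And>j. extend_zero (L j) (f j) t = 0" for t
    using LIMSEQ_unique[OF tend[OF that(1)]] that(2) by simp
  have "extend_zero (L j) (f j) 0 = 0" "extend_zero (L j) (f j) D = 0" for j
    using g[of j] LD[of j] by (auto simp: extend_zero_def rot_symmetric_sphere_def)
  then have ends: "f_lim 0 = 0" "f_lim D = 0" using zero D by auto
  define X where "X = {s\<in>{0..D}. \<forall>t\<in>{0..s}. f_lim t = 0}"
  define Y where "Y = {s\<in>{0..D}. \<forall>t\<in>{s..D}. f_lim t = 0}"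
  have X: "x \<in> X \<Longrightarrow> x < s" for x
  proof -
    assume "x \<in> X"
    moreover have "bdd_above X" unfolding X_def by (rule bdd_aboveI[of _ D]) auto
    ultimately have "x \<le> a_end D f_lim" unfolding a_end_def X_def by (intro cSup_upper)
    then show "x < s" using s by simp
  qed
  have Y: "s < y" if "y \<in> Y" for y
  proof -
    have "bdd_below Y" unfolding Y_def by (rule bdd_belowI[of _ 0]) auto
    then have "b_end D f_lim \<le> y" unfolding b_end_def using that unfolding Y_def by (intro cInf_lower)
    then show "s < y" using s by simp
  qed
  have "0 \<in> X" "D \<in> Y" using ends D by (auto simp: X_def Y_def)
  then show sD: "s \<in> {0<..<D}" using X Y by auto
  have "s \<notin> X" "s \<notin> Y" using X Y by blast+
  then obtain p q where p: "p \<in> {0..s}" "f_lim p \<noteq> 0" and q: "q \<in> {s..D}" "f_lim q \<noteq> 0"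
    using sD unfolding X_def Y_def by auto
  show "f_lim s > 0"
  proof (rule ccontr)
    assume "\<not> f_lim s > 0"
    then have s0: "f_lim s = 0" using nonneg[of s] sD by auto
    have pp: "f_lim p > 0" "f_lim q > 0" using nonneg[of p] nonneg[of q] p q sD by auto
    have lt: "p < s" "s < q" using p q s0 by (auto simp: le_less)
    \<comment> \<open>above the values at \<open>s\<close>, below those at \<open>p\<close> and \<open>q\<close>, and not above the lower bound \<open>\<epsilon>\<close> for the radius of a neck\<close>
    define \<delta> where "\<delta> = min (min (f_lim p) (f_lim q) / 2) \<epsilon>"
    have \<delta>: "0 < \<delta>" "\<delta> < f_lim p" "\<delta> < f_lim q" "\<delta> \<le> \<epsilon>" using pp \<epsilon> by (auto simp: \<delta>_def)
    have "\<forall>\<^sub>F j in sequentially. \<delta> < extend_zero (L j) (f j) p \<and> \<delta> < extend_zero (L j) (f j) q \<and> extend_zero (L j) (f j) s < \<delta>"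
      using p q sD \<delta> s0
      by (intro eventually_conj order_tendstoD(1)[OF tend] order_tendstoD(2)[OF tend]) auto
    then obtain j where j: "\<delta> < extend_zero (L j) (f j) p" "\<delta> < extend_zero (L j) (f j) q" "extend_zero (L j) (f j) s < \<delta>"
      using eventually_happens'[OF sequentially_bot] by blast
    note e = extend_zero_properties[OF g[of j]]
    have "p \<in> {0<..<L j}" "q \<in> {0<..<L j}" using e(3)[of p] e(3)[of q] j(1,2) \<delta>(1) by linarith+
    moreover from this have "s \<in> {0<..<L j}" using lt by auto
    ultimately have jf: "0 < p" "q < L j" "\<delta> < f j p" "\<delta> < f j q" "f j s < \<delta>"
      using j e(4)[of p] e(4)[of q] e(4)[of s] by auto
    obtain m where m: "m \<in> {0<..<L j}" "deriv (f j) m = 0" "f j m \<le> f j s"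
      by (rule interior_minimum_below[OF g jf(1) lt jf(2)]) (use jf in auto)
    then show False using neck[OF m(1,2)] jf(5) \<delta>(4) by linarith
  qed
qed

section \<open>The inequality along a meridian\<close>

text \<open>
  The exponent \<open>3/2\<close> is the one for which the second derivative contains \<open>f'\<^sup>2\<close> and \<open>f f''\<close> in the ratio \<open>1 : 2\<close> of the
  scalar curvature condition.
\<close>

lemma profile_power_derivatives:
  fixes f f' :: "real \<Rightarrow> real"
  assumes "f s > 0" "(f has_real_derivative f' s) (at s)" "(f' has_real_derivative f2) (at s)"
  shows "((\<lambda>t. f t powr (3/2)) has_real_derivative 3/2 * f s powr (1/2) * f' s) (at s)"
    "((\<lambda>t. 3/2 * f t powr (1/2) * f' t) has_real_derivative 3/4 * f s powr (-1/2) * ((f' s)\<^sup>2 + 2 * f s * f2)) (at s)"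
proof -
  have p: "f s powr (1/2) = f s * f s powr (-1/2)"
    using powr_mult_base[of "f s" "-1/2"] assms(1) by simp
  show "((\<lambda>t. f t powr (3/2)) has_real_derivative 3/2 * f s powr (1/2) * f' s) (at s)"
    using assms(1,2) by (auto intro!: derivative_eq_intros)
  have "((\<lambda>t. f t powr (1/2)) has_real_derivative 1/2 * f s powr (-1/2) * f' s) (at s)"
    using assms(1,2) by (auto intro!: derivative_eq_intros)
  then have "((\<lambda>t. 3/2 * f t powr (1/2) * f' t) has_real_derivative
      3/2 * f s powr (1/2) * f2 + 3/2 * (1/2 * f s powr (-1/2) * f' s) * f' s) (at s)"
    by (rule DERIV_mult'[OF DERIV_cmult assms(3)])
  then show "((\<lambda>t. 3/2 * f t powr (1/2) * f' t) has_real_derivative 3/4 * f s powr (-1/2) * ((f' s)\<^sup>2 + 2 * f s * f2)) (at s)"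
    unfolding p by (rule DERIV_cong) (simp add: power2_eq_square algebra_simps)
qed

text \<open>
  Integration by parts is the fundamental theorem applied to \<open>h \<phi>' - h' \<phi>\<close>, which vanishes at both ends.
  Its derivative \<open>h \<phi>'' - h'' \<phi>\<close> dominates the integrand, as the test function is nonnegative.
\<close>

lemma weak_inequality_smooth:
  fixes f f' f'' \<phi> \<phi>' \<phi>'' :: "real \<Rightarrow> real"
  assumes cd: "c \<le> d"
    and f: "\<And>s. s \<in> {c..d} \<Longrightarrow> f s > 0" "\<And>s. s \<in> {c..d} \<Longrightarrow> (f has_real_derivative f' s) (at s)"
      "\<And>s. s \<in> {c..d} \<Longrightarrow> (f' has_real_derivative f'' s) (at s)"
    and sc: "\<And>s. s \<in> {c..d} \<Longrightarrow> 2 * f s * f'' s \<le> 1 - (f' s)\<^sup>2"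
    and \<phi>: "\<And>s. s \<in> {c..d} \<Longrightarrow> (\<phi> has_real_derivative \<phi>' s) (at s)"
      "\<And>s. s \<in> {c..d} \<Longrightarrow> (\<phi>' has_real_derivative \<phi>'' s) (at s)" "continuous_on {c..d} \<phi>''"
      "\<And>s. s \<in> {c..d} \<Longrightarrow> \<phi> s \<ge> 0"
    and bd: "\<phi> c = 0" "\<phi>' c = 0" "\<phi> d = 0" "\<phi>' d = 0"
  shows "(\<lambda>s. f s powr (3/2) * \<phi>'' s - 3/4 * f s powr (-1/2) * \<phi> s) integrable_on {c..d}"
    "integral {c..d} (\<lambda>s. f s powr (3/2) * \<phi>'' s - 3/4 * f s powr (-1/2) * \<phi> s) \<le> 0"
proof -
  let ?h = "\<lambda>s. f s powr (3/2)" and ?h' = "\<lambda>s. 3/2 * f s powr (1/2) * f' s"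
    and ?h2 = "\<lambda>s. 3/4 * f s powr (-1/2) * ((f' s)\<^sup>2 + 2 * f s * f'' s)"
  have "((\<lambda>s. ?h s * \<phi>'' s - ?h2 s * \<phi> s) has_integral
      (?h d * \<phi>' d - ?h' d * \<phi> d) - (?h c * \<phi>' c - ?h' c * \<phi> c)) {c..d}"
  proof (rule fundamental_theorem_of_calculus[OF cd])
    fix s assume s: "s \<in> {c..d}"
    have "((\<lambda>s. ?h s * \<phi>' s - ?h' s * \<phi> s) has_real_derivative
       (?h s * \<phi>'' s + ?h' s * \<phi>' s) - (?h' s * \<phi>' s + ?h2 s * \<phi> s)) (at s)"
      by (rule DERIV_diff DERIV_mult' profile_power_derivatives[where f = f and f' = f'] f \<phi> s)+
    then show "((\<lambda>s. ?h s * \<phi>' s - ?h' s * \<phi> s) has_vector_derivative ?h s * \<phi>'' s - ?h2 s * \<phi> s) (at s within {c..d})"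
      by (simp add: has_real_derivative_iff_has_vector_derivative has_vector_derivative_at_within)
  qed
  then have I: "((\<lambda>s. ?h s * \<phi>'' s - ?h2 s * \<phi> s) has_integral 0) {c..d}" by (simp add: bd)
  have cf: "continuous_on {c..d} f" "continuous_on {c..d} \<phi>"
    by (rule continuous_at_imp_continuous_on; use f(2) \<phi>(1) in \<open>blast intro: DERIV_isCont\<close>)+
  have ne: "\<forall>s\<in>{c..d}. f s \<noteq> 0" using f(1) by force
  show int: "(\<lambda>s. f s powr (3/2) * \<phi>'' s - 3/4 * f s powr (-1/2) * \<phi> s) integrable_on {c..d}"
    by (intro integrable_continuous_interval continuous_intros cf \<phi>(3) ne)
  show "integral {c..d} (\<lambda>s. f s powr (3/2) * \<phi>'' s - 3/4 * f s powr (-1/2) * \<phi> s) \<le> 0"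
  proof (rule has_integral_le[OF integrable_integral[OF int] I])
    fix s assume s: "s \<in> {c..d}"
    have "3/4 * f s powr (-1/2) * ((f' s)\<^sup>2 + 2 * f s * f'' s) \<le> 3/4 * f s powr (-1/2) * 1"
      using sc[OF s] by (intro mult_left_mono) auto
    then have "?h2 s * \<phi> s \<le> 3/4 * f s powr (-1/2) * \<phi> s"
      unfolding mult_1_right by (rule mult_right_mono[OF _ \<phi>(4)[OF s]])
    then show "f s powr (3/2) * \<phi>'' s - 3/4 * f s powr (-1/2) * \<phi> s \<le> ?h s * \<phi>'' s - ?h2 s * \<phi> s" by simp
  qed
qed

text \<open>
  On the compact interval the limit is bounded away from zero, so eventually all the functions lie between two
  positive constants.  The integrands are then bounded by a common constant and converge pointwise.
\<close>

lemma weak_inequality_limit: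
  fixes L :: "nat \<Rightarrow> real" and \<phi> \<phi>' \<phi>'' :: "real \<Rightarrow> real"
  assumes g: "\<And>j. rot_symmetric_sphere (L j) (f j) (g j)" and sc: "\<And>j. nonneg_scalar3 S3 (g j)"
    and lim: "uniform_limit {0..D} (\<lambda>j. extend_zero (L j) (f j)) f_lim sequentially"
    and cd: "c \<le> d" "{c..d} \<subseteq> {0..D}" and pos: "\<And>s. s \<in> {c..d} \<Longrightarrow> f_lim s > 0"
    and \<phi>: "\<And>s. s \<in> {c..d} \<Longrightarrow> (\<phi> has_real_derivative \<phi>' s) (at s)"
      "\<And>s. s \<in> {c..d} \<Longrightarrow> (\<phi>' has_real_derivative \<phi>'' s) (at s)" "continuous_on {c..d} \<phi>''"
      "\<And>s. s \<in> {c..d} \<Longrightarrow> \<phi> s \<ge> 0"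
    and bd: "\<phi> c = 0" "\<phi>' c = 0" "\<phi> d = 0" "\<phi>' d = 0"
  shows "integral {c..d} (\<lambda>s. f_lim s powr (3/2) * \<phi>'' s - 3/4 * f_lim s powr (-1/2) * \<phi> s) \<le> 0"
proof -
  let ?F = "\<lambda>j. extend_zero (L j) (f j)"
  have lim': "uniform_limit {c..d} ?F f_lim sequentially" by (rule uniform_limit_on_subset[OF lim cd(2)])
  have cF: "continuous_on {c..d} (?F j)" for j
    by (rule continuous_on_subset[OF extend_zero_properties(1)[OF g]]) (use cd(2) in auto)
  have cl: "continuous_on {c..d} f_lim"
    by (rule uniform_limit_theorem[OF _ lim']) (use cF in auto)
  obtain x where x: "x \<in> {c..d}" "\<And>s. s \<in> {c..d} \<Longrightarrow> f_lim x \<le> f_lim s"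
    using continuous_attains_inf[OF _ _ cl] cd(1) by auto
  obtain y where y: "y \<in> {c..d}" "\<And>s. s \<in> {c..d} \<Longrightarrow> f_lim s \<le> f_lim y"
    using continuous_attains_sup[OF _ _ cl] cd(1) by auto
  define \<delta> where "\<delta> = f_lim x / 2"
  have \<delta>: "\<delta> > 0" using pos[OF x(1)] by (simp add: \<delta>_def)
  define m where "m = f_lim y + \<delta>"
  have "\<forall>\<^sub>F j in sequentially. \<forall>s\<in>{c..d}. dist (?F j s) (f_lim s) < \<delta>"
    using lim' \<delta> by (rule uniform_limitD)
  then obtain N where N: "\<And>j s. j \<ge> N \<Longrightarrow> s \<in> {c..d} \<Longrightarrow> \<bar>?F j s - f_lim s\<bar> < \<delta>"
    unfolding eventually_sequentially dist_real_def by blast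
  have bnd: "\<delta> \<le> ?F j s" "?F j s \<le> m" if "j \<ge> N" "s \<in> {c..d}" for j s
    using N[OF that] x(2)[OF that(2)] y(2)[OF that(2)] unfolding abs_less_iff m_def \<delta>_def by linarith+
  define G where "G j s = ?F j s powr (3/2) * \<phi>'' s - 3/4 * ?F j s powr (-1/2) * \<phi> s" for j s
  have ineq: "G j integrable_on {c..d}" "integral {c..d} (G j) \<le> 0" if j: "j \<ge> N" for j
  proof -
    have s: "s \<in> {0<..<L j}" "f j s = ?F j s" if "s \<in> {c..d}" for s
      using bnd(1)[OF j that] \<delta> extend_zero_properties(3,4)[OF g[of j], of s] by auto
    have 1: "f j s > 0" "(f j has_real_derivative deriv (f j) s) (at s)" "(deriv (f j) has_real_derivative deriv (deriv (f j)) s) (at s)"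
      "2 * f j s * deriv (deriv (f j)) s \<le> 1 - (deriv (f j) s)\<^sup>2" if "s \<in> {c..d}" for s
      using s(1)[OF that] warping_function_pos[OF g] warping_function_derivatives[OF g] scalar_curvature_inequality[OF g sc] by auto
    note w = weak_inequality_smooth[OF cd(1) 1 \<phi> bd]
    have eq: "f j s powr (3/2) * \<phi>'' s - 3/4 * f j s powr (-1/2) * \<phi> s = G j s" if "s \<in> {c..d}" for s
      using s(2)[OF that] by (simp add: G_def)
    show "G j integrable_on {c..d}" by (rule integrable_eq[OF w(1) eq])
    have "integral {c..d} (\<lambda>s. f j s powr (3/2) * \<phi>'' s - 3/4 * f j s powr (-1/2) * \<phi> s) = integral {c..d} (G j)"
      by (rule Henstock_Kurzweil_Integration.integral_cong) (rule eq)
    with w(2) show "integral {c..d} (G j) \<le> 0" by (simp only:)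
  qed
  have c\<phi>: "continuous_on {c..d} \<phi>"
    by (rule continuous_at_imp_continuous_on) (use \<phi>(1) in \<open>blast intro: DERIV_isCont\<close>)
  obtain P where P: "\<And>s. s \<in> {c..d} \<Longrightarrow> \<bar>\<phi> s\<bar> \<le> P"
    using continuous_on_compact_bound[OF compact_Icc c\<phi>] unfolding real_norm_def by metis
  obtain Q where Q: "\<And>s. s \<in> {c..d} \<Longrightarrow> \<bar>\<phi>'' s\<bar> \<le> Q"
    using continuous_on_compact_bound[OF compact_Icc \<phi>(3)] unfolding real_norm_def by metis
  have "(\<lambda>k. integral {c..d} (G (k + N))) \<longlonglongrightarrow> integral {c..d} (\<lambda>s. f_lim s powr (3/2) * \<phi>'' s - 3/4 * f_lim s powr (-1/2) * \<phi> s)"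
  proof (rule dominated_convergence(2))
    show "G (k + N) integrable_on {c..d}" for k by (rule ineq) simp
    show "(\<lambda>_. m powr (3/2) * Q + 3/4 * \<delta> powr (-1/2) * P) integrable_on {c..d}" by auto
    show "norm (G (k + N) s) \<le> m powr (3/2) * Q + 3/4 * \<delta> powr (-1/2) * P" if s: "s \<in> {c..d}" for k s
    proof -
      have b: "\<delta> \<le> ?F (k + N) s" "?F (k + N) s \<le> m" using bnd[of "k + N" s] s by auto
      have "?F (k + N) s powr (3/2) \<le> m powr (3/2)" using b \<delta> by (intro powr_mono2) auto
      moreover have "?F (k + N) s powr (-1/2) \<le> \<delta> powr (-1/2)" using b \<delta> by (intro powr_mono2') auto
      ultimately have "?F (k + N) s powr (3/2) * \<bar>\<phi>'' s\<bar> \<le> m powr (3/2) * Q"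
        "?F (k + N) s powr (-1/2) * \<bar>\<phi> s\<bar> \<le> \<delta> powr (-1/2) * P"
        using P[OF s] Q[OF s] by (auto intro!: mult_mono)
      moreover have "norm (G (k + N) s) \<le> ?F (k + N) s powr (3/2) * \<bar>\<phi>'' s\<bar> + 3/4 * (?F (k + N) s powr (-1/2) * \<bar>\<phi> s\<bar>)"
        unfolding G_def by (rule order_trans[OF norm_triangle_ineq4]) (simp add: abs_mult)
      ultimately show ?thesis by simp
    qed
    show "(\<lambda>k. G (k + N) s) \<longlonglongrightarrow> f_lim s powr (3/2) * \<phi>'' s - 3/4 * f_lim s powr (-1/2) * \<phi> s" if s: "s \<in> {c..d}" for s
    proof -
      have "(\<lambda>k. ?F (k + N) s) \<longlonglongrightarrow> f_lim s"
        by (rule LIMSEQ_ignore_initial_segment[OF tendsto_uniform_limitI[OF lim' s]])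
      then show ?thesis unfolding G_def using pos[OF s] by (intro tendsto_intros) auto
    qed
  qed
  then show "integral {c..d} (\<lambda>s. f_lim s powr (3/2) * \<phi>'' s - 3/4 * f_lim s powr (-1/2) * \<phi> s) \<le> 0"
    by (rule LIMSEQ_le_const2) (use ineq(2) in auto)
qed

section \<open>Test functions on the cylinder\<close>

lemma Ck_on_fst_derivative:
  fixes F :: "real \<times> (real^3) \<Rightarrow> real"
  assumes "Ck_on (Suc k) F U" "(t, w) \<in> U"
  shows "((\<lambda>t. F (t, w)) has_real_derivative frechet_derivative F (at (t, w)) (1, 0)) (at t)"
proof -
  note d = Ck_on_has_derivative[OF assms]
  have "((\<lambda>t. (t, w)) has_derivative (\<lambda>h. (h, 0))) (at t)" by (intro derivative_eq_intros) auto
  from diff_chain_at[OF this d]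
  have "((\<lambda>t. F (t, w)) has_derivative (\<lambda>h. frechet_derivative F (at (t, w)) (h, 0))) (at t)"
    by (simp add: o_def)
  moreover have "(\<lambda>h. frechet_derivative F (at (t, w)) (h, 0)) = (*) (frechet_derivative F (at (t, w)) (1, 0))"
  proof (rule ext)
    fix h :: real
    have "(h, 0) = h *\<^sub>R (1, 0 :: real^3)" by simp
    then have "frechet_derivative F (at (t, w)) (h, 0) = h *\<^sub>R frechet_derivative F (at (t, w)) (1, 0)"
      by (simp only: linear_scale[OF has_derivative_linear[OF d]])
    also have "\<dots> = frechet_derivative F (at (t, w)) (1, 0) * h" unfolding real_scaleR_def by (rule mult.commute)
    finally show "frechet_derivative F (at (t, w)) (h, 0) = frechet_derivative F (at (t, w)) (1, 0) * h" .
  qed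
  ultimately show ?thesis unfolding has_field_derivative_def by (simp only:)
qed

text \<open>
  The second \<open>s\<close>-derivative of a smooth function on the cylinder is the restriction of a directional derivative of
  any local extension, since the cylinder is open in the \<open>s\<close>-direction.  In particular it is jointly continuous.
\<close>

lemma smooth_on_cylinder_pd_ss:
  assumes v: "smooth_on ({a<..<b} \<times> S2) v"
  shows "continuous_on ({a<..<b} \<times> S2) (pd_ss v)"
    and "s \<in> {a<..<b} \<Longrightarrow> w \<in> S2 \<Longrightarrow> ((\<lambda>t. v (t, w)) has_real_derivative deriv (\<lambda>t. v (t, w)) s) (at s)"
    and "s \<in> {a<..<b} \<Longrightarrow> w \<in> S2 \<Longrightarrow> (deriv (\<lambda>t. v (t, w)) has_real_derivative pd_ss v (s, w)) (at s)"
proof -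
  let ?M = "{a<..<b} \<times> S2"
  define Q where "Q = (\<lambda>s w. ((\<lambda>t. v (t, w)) has_real_derivative deriv (\<lambda>t. v (t, w)) s) (at s) \<and>
      (deriv (\<lambda>t. v (t, w)) has_real_derivative pd_ss v (s, w)) (at s))"
  have main: "\<exists>U F. open U \<and> p \<in> U \<and> continuous_on U F \<and> (\<forall>y\<in>U \<inter> ?M. F y = pd_ss v y \<and> Q (fst y) (snd y))"
    if p: "p \<in> ?M" for p
  proof -
    from bspec[OF v[unfolded smooth_on_def] p]
    obtain U F where U: "open U" "p \<in> U" "\<forall>k. Ck_on k F U" "\<forall>y\<in>U \<inter> ?M. F y = v y" by (elim exE conjE)
    define F1 where "F1 x = frechet_derivative F (at x) (1, 0)" for x
    define F2 where "F2 x = frechet_derivative F1 (at x) (1, 0)" for x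
    have C2: "Ck_on (Suc (Suc 0)) F U" using U(3) by blast
    then have C1: "Ck_on (Suc 0) F1 U" unfolding F1_def by simp
    then have C0: "continuous_on U F2" unfolding F2_def by simp
    have F2: "F2 (s, w) = pd_ss v (s, w) \<and> Q s w" if sw: "(s, w) \<in> U \<inter> ?M" for s w
    proof -
      define V where "V = {a<..<b} \<inter> (\<lambda>t. (t, w)) -` U"
      have V: "open V" unfolding V_def
        by (intro open_Int open_greaterThanLessThan open_vimage U(1) continuous_intros)
      have sV: "s \<in> V" using sw by (simp add: V_def)
      have w: "w \<in> S2" using sw by simp
      have VU: "(t, w) \<in> U" if "t \<in> V" for t using that by (simp add: V_def)
      have eq: "F (t, w) = v (t, w)" if "t \<in> V" for t using U(4) that w by (simp add: V_def)
      have d1: "((\<lambda>t. v (t, w)) has_real_derivative F1 (t, w)) (at t)" if t: "t \<in> V" for t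
        unfolding F1_def
        by (rule has_field_derivative_transform_within_open[OF Ck_on_fst_derivative[OF C2 VU[OF t]] V t]) (rule eq)
      have e1: "deriv (\<lambda>t. v (t, w)) t = F1 (t, w)" if "t \<in> V" for t
        by (rule DERIV_imp_deriv[OF d1[OF that]])
      have d2: "(deriv (\<lambda>t. v (t, w)) has_real_derivative F2 (s, w)) (at s)"
        unfolding F2_def
        by (rule has_field_derivative_transform_within_open[OF Ck_on_fst_derivative[OF C1 VU[OF sV]] V sV]) (rule e1[symmetric])
      have e2: "pd_ss v (s, w) = F2 (s, w)"
        unfolding pd_ss_def prod.case by (rule DERIV_imp_deriv[OF d2])
      show ?thesis using d1[OF sV] d2 unfolding Q_def e1[OF sV] e2 by blast
    qed
    show ?thesis
    proof (intro exI[of _ U] exI[of _ F2] conjI ballI U(1,2) C0)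
      fix y assume "y \<in> U \<inter> ?M"
      then show "F2 y = pd_ss v y" "Q (fst y) (snd y)" using F2[of "fst y" "snd y"] by auto
    qed
  qed
  show "continuous_on ?M (pd_ss v)"
  proof (rule continuous_on_locally_agree)
    fix p assume "p \<in> ?M"
    from main[OF this] show "\<exists>U F. open U \<and> p \<in> U \<and> continuous_on U F \<and> (\<forall>y\<in>U \<inter> ?M. F y = pd_ss v y)"
      by blast
  qed
  assume "s \<in> {a<..<b}" "w \<in> S2"
  then have sw: "(s, w) \<in> ?M" by simp
  from main[OF this] have "Q s w" using sw by force
  from conjunct1[OF \<open>Q s w\<close>[unfolded Q_def]] show "((\<lambda>t. v (t, w)) has_real_derivative deriv (\<lambda>t. v (t, w)) s) (at s)" .
  from conjunct2[OF \<open>Q s w\<close>[unfolded Q_def]] show "(deriv (\<lambda>t. v (t, w)) has_real_derivative pd_ss v (s, w)) (at s)" .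
qed

lemma compact_in_open_interval:
  fixes a b :: real
  assumes "compact C" "C \<subseteq> {a<..<b}" "a < b"
  obtains c d where "a < c" "c \<le> d" "d < b" "C \<subseteq> {c<..<d}"
proof (cases "C = {}")
  case True
  show thesis
  proof (rule that)
    show "a < (a + b) / 2" "(a + b) / 2 \<le> (a + b) / 2" "(a + b) / 2 < b" using assms(3) by simp_all
    show "C \<subseteq> {(a + b) / 2<..<(a + b) / 2}" unfolding True by simp
  qed
next
  case False
  obtain m where m: "m \<in> C" "\<forall>x\<in>C. m \<le> x" by (rule bexE[OF compact_attains_inf[OF assms(1) False]])
  obtain n where n: "n \<in> C" "\<forall>x\<in>C. x \<le> n" by (rule bexE[OF compact_attains_sup[OF assms(1) False]])
  have mn: "a < m" "m \<le> n" "n < b" using m n assms(2) by auto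
  show thesis
  proof (rule that[of "(a + m) / 2" "(n + b) / 2"])
    show "C \<subseteq> {(a + m) / 2<..<(n + b) / 2}"
    proof
      fix x assume "x \<in> C"
      with m(2) n(2) have "m \<le> x" "x \<le> n" by blast+
      with mn show "x \<in> {(a + m) / 2<..<(n + b) / 2}" by auto
    qed
  qed (use mn in auto)
qed

text \<open>
  The interval \<open>[c,d]\<close> is slightly larger than the projection of the support, so that the test function and its
  derivatives vanish at \<open>c\<close> and \<open>d\<close> as well; these are the boundary terms in the integration by parts.
\<close>

lemma test_function_support:
  assumes v: "test_function ({a<..<b} \<times> S2) v" and ab: "a < b"
  obtains c d where "a < c" "c \<le> d" "d < b"
    "\<And>s w. s \<in> {a<..<b} \<Longrightarrow> s \<notin> {c<..<d} \<Longrightarrow> w \<in> S2 \<Longrightarrow>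
       v (s, w) = 0 \<and> deriv (\<lambda>t. v (t, w)) s = 0 \<and> pd_ss v (s, w) = 0"
proof -
  obtain K where K: "compact K" "K \<subseteq> {a<..<b} \<times> S2" "\<forall>z\<in>{a<..<b} \<times> S2 - K. v z = 0"
    using v unfolding test_function_def by (elim conjE exE)
  have C: "compact (fst ` K)" by (intro compact_continuous_image continuous_intros K(1))
  have "fst ` K \<subseteq> {a<..<b}" using K(2) by auto
  from compact_in_open_interval[OF C this ab] obtain c d
    where cd: "a < c" "c \<le> d" "d < b" "fst ` K \<subseteq> {c<..<d}" .
  have *: "v (s, w) = 0 \<and> deriv (\<lambda>t. v (t, w)) s = 0 \<and> pd_ss v (s, w) = 0"
    if s: "s \<in> {a<..<b}" "s \<notin> {c<..<d}" and w: "w \<in> S2" for s w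
  proof -
    define Z where "Z = {a<..<b} - fst ` K"
    have Z: "open Z" unfolding Z_def using C by (intro open_Diff compact_imp_closed) auto
    have sZ: "s \<in> Z" using s cd(4) by (auto simp: Z_def)
    have vz: "v (t, w) = 0" if "t \<in> Z" for t
    proof -
      have "(t, w) \<in> {a<..<b} \<times> S2 - K" using that w by (force simp: Z_def)
      then show ?thesis using K(3) by blast
    qed
    have d1: "deriv (\<lambda>t. v (t, w)) t = 0" if t: "t \<in> Z" for t
      by (rule DERIV_imp_deriv, rule has_field_derivative_transform_within_open[OF DERIV_const Z t]) (rule vz[symmetric])
    have "deriv (deriv (\<lambda>t. v (t, w))) s = 0"
      by (rule DERIV_imp_deriv, rule has_field_derivative_transform_within_open[OF DERIV_const Z sZ]) (rule d1[symmetric])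
    then show ?thesis using vz[OF sZ] d1[OF sZ] by (simp add: pd_ss_def)
  qed
  show thesis by (rule that[OF cd(1,2,3)]) (rule *)
qed

section \<open>Integration over the sphere\<close>

lemma sphere_vol_param_measurable:
  "(\<lambda>(\<alpha>, \<beta>). vector [sin \<alpha> * cos \<beta>, sin \<alpha> * sin \<beta>, cos \<alpha>] :: real^3) \<in> borel_measurable borel"
proof -
  have e: "(\<lambda>(\<alpha>, \<beta>). vector [sin \<alpha> * cos \<beta>, sin \<alpha> * sin \<beta>, cos \<alpha>] :: real^3) =
     (\<lambda>x. (sin (fst x) * cos (snd x)) *\<^sub>R axis 1 1 + (sin (fst x) * sin (snd x)) *\<^sub>R axis 2 1 + cos (fst x) *\<^sub>R axis 3 1)"
    by (auto simp: fun_eq_iff vec_eq_iff forall_3 axis_def)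
  show ?thesis unfolding e by (intro borel_measurable_continuous_onI continuous_intros)
qed

lemma sphere_vol_weight_measurable:
  "(\<lambda>(\<alpha>::real, \<beta>::real). ennreal (sin \<alpha>) * indicator ({0..pi} \<times> {0..2 * pi}) (\<alpha>, \<beta>)) \<in> borel_measurable borel"
proof -
  have "closed ({0..pi} \<times> {0..2 * pi})" by (intro closed_Times closed_atLeastAtMost)
  then have "{0..pi} \<times> {0..2 * pi} \<in> sets borel" by (rule borel_closed)
  moreover have "(\<lambda>x::real \<times> real. sin (fst x)) \<in> borel_measurable borel"
    by (intro borel_measurable_continuous_onI continuous_intros)
  ultimately show ?thesis unfolding case_prod_unfold prod.collapse
    by (intro borel_measurable_times_ennreal measurable_compose[OF _ measurable_ennreal] borel_measurable_indicator)
qed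

lemma sets_sphere_vol: "sets sphere_vol = sets borel"
  by (simp add: sphere_vol_def)

lemma finite_measure_sphere_vol: "finite_measure sphere_vol"
proof
  let ?w = "\<lambda>(\<alpha>, \<beta>). ennreal (sin \<alpha>) * indicator ({0..pi} \<times> {0..2 * pi}) (\<alpha>, \<beta>)"
  have B: "{0..pi} \<times> {0..2 * pi} \<in> sets borel"
    by (intro borel_closed closed_Times closed_atLeastAtMost)
  have "emeasure sphere_vol (space sphere_vol) = (\<integral>\<^sup>+x. ?w x \<partial>lborel)"
    unfolding sphere_vol_def
    using sphere_vol_param_measurable sphere_vol_weight_measurable
    by (simp add: emeasure_distr emeasure_density)
  also have "\<dots> \<le> (\<integral>\<^sup>+x. indicator ({0..pi} \<times> {0..2 * pi}) x \<partial>lborel)"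
  proof (rule nn_integral_mono)
    fix x :: "real \<times> real"
    have "ennreal (sin (fst x)) * i \<le> 1 * i" for i
      by (intro mult_right_mono) (auto simp: ennreal_le_1)
    then show "?w x \<le> indicator ({0..pi} \<times> {0..2 * pi}) x" by (simp add: case_prod_unfold)
  qed
  also have "\<dots> = emeasure lborel ({0..pi} \<times> {0..2 * pi})" using B by simp
  also have "\<dots> < \<infinity>"
    by (intro emeasure_bounded_finite bounded_Times bounded_closed_interval)
  finally show "emeasure sphere_vol (space sphere_vol) \<noteq> \<infinity>" by simp
qed

lemma integrable_compact_lborel_sphere_vol:
  fixes q :: "real \<times> (real^3) \<Rightarrow> real"
  assumes K: "compact K" and q: "continuous_on K q"
  shows "integrable (lborel \<Otimes>\<^sub>M sphere_vol) (\<lambda>z. indicator K z *\<^sub>R q z)"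
proof -
  interpret sv: finite_measure sphere_vol by (rule finite_measure_sphere_vol)
  let ?N = "lborel \<Otimes>\<^sub>M sphere_vol :: (real \<times> (real^3)) measure"
  have sN: "sets ?N = sets borel"
  proof -
    have "sets ?N = sets (borel \<Otimes>\<^sub>M borel)" by (rule sets_pair_measure_cong[OF sets_lborel sets_sphere_vol])
    also have "\<dots> = sets borel" by (rule arg_cong[OF borel_prod])
    finally show ?thesis .
  qed
  have Kb: "K \<in> sets borel" using K by (intro borel_closed compact_imp_closed)
  have mq: "(\<lambda>z. indicator K z *\<^sub>R q z) \<in> borel_measurable ?N"
    unfolding measurable_cong_sets[OF sN refl] by (rule borel_measurable_continuous_on_indicator[OF Kb q])
  obtain B where B: "\<And>z. z \<in> K \<Longrightarrow> norm (q z) \<le> B" using continuous_on_compact_bound[OF K q] by metis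
  have cf: "compact (fst ` K)" by (intro compact_continuous_image continuous_intros K)
  then have fK: "fst ` K \<in> sets lborel" by (simp add: borel_compact)
  have fin: "emeasure lborel (fst ` K) < \<infinity>" by (rule emeasure_bounded_finite[OF compact_imp_bounded[OF cf]])
  have us: "UNIV \<in> sets sphere_vol" by (simp add: sets_sphere_vol)
  have "emeasure ?N K \<le> emeasure ?N (fst ` K \<times> UNIV)"
  proof (rule emeasure_mono)
    show "K \<subseteq> fst ` K \<times> UNIV" by (rule subsetI) (simp add: mem_Times_iff)
    show "fst ` K \<times> UNIV \<in> sets ?N" by (rule pair_measureI[OF fK us])
  qed
  also have "\<dots> = emeasure lborel (fst ` K) * emeasure sphere_vol UNIV"
    by (rule sv.emeasure_pair_measure_Times[OF fK us])
  also have "\<dots> < \<infinity>"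
    using fin by (simp add: ennreal_mult_eq_top_iff less_top[symmetric])
  finally have eK: "emeasure ?N K < \<infinity>" .
  \<comment> \<open>the inner indicator makes the integrand measurable on the whole space\<close>
  have "integrable ?N (\<lambda>z. indicator K z *\<^sub>R (indicator K z *\<^sub>R q z))"

  proof (rule integrableI_bounded_set_indicator[OF _ mq eK])
    show "K \<in> sets ?N" unfolding sN by (rule Kb)
    show "AE z in ?N. z \<in> K \<longrightarrow> norm (indicator K z *\<^sub>R q z) \<le> B" using B by simp
  qed
  moreover have "(\<lambda>z. indicator K z *\<^sub>R (indicator K z *\<^sub>R q z)) = (\<lambda>z. indicator K z *\<^sub>R q z)"
    by (auto simp: fun_eq_iff indicator_def)
  ultimately show ?thesis by (simp only:)
qed

text \<open>
  All integrands vanish off the compact set \<open>[c,d] \<times> S\<^sup>2\<close>, where they are continuous, and the product measure is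
  finite there.  Fubini's theorem reduces the claim to one inner integral over \<open>s\<close> for each direction.
\<close>

lemma distributional_inequality_from_meridians:
  fixes h k :: "real \<Rightarrow> real"
  assumes ab: "a < b" and h: "continuous_on {a<..<b} h" and k: "continuous_on {a<..<b} k"
    and v: "test_function ({a<..<b} \<times> S2) v" "\<And>z. z \<in> {a<..<b} \<times> S2 \<Longrightarrow> v z \<ge> 0"
    and meridian: "\<And>c d \<phi> \<phi>' \<phi>''. a < c \<Longrightarrow> c \<le> d \<Longrightarrow> d < b \<Longrightarrow>
        (\<And>s. s \<in> {c..d} \<Longrightarrow> (\<phi> has_real_derivative \<phi>' s) (at s)) \<Longrightarrow>
        (\<And>s. s \<in> {c..d} \<Longrightarrow> (\<phi>' has_real_derivative \<phi>'' s) (at s)) \<Longrightarrow> continuous_on {c..d} \<phi>'' \<Longrightarrow>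
        (\<And>s. s \<in> {c..d} \<Longrightarrow> \<phi> s \<ge> 0) \<Longrightarrow> \<phi> c = 0 \<Longrightarrow> \<phi>' c = 0 \<Longrightarrow> \<phi> d = 0 \<Longrightarrow> \<phi>' d = 0 \<Longrightarrow>
        integral {c..d} (\<lambda>s. h s * \<phi>'' s - k s * \<phi> s) \<le> 0"
  defines "M \<equiv> {a<..<b} \<times> S2" and "N \<equiv> lborel \<Otimes>\<^sub>M sphere_vol"
  shows "set_integrable N M (\<lambda>z. h (fst z) * pd_ss v z)" "set_integrable N M (\<lambda>z. k (fst z) * v z)"
    "(LINT z:M|N. h (fst z) * pd_ss v z) \<le> (LINT z:M|N. k (fst z) * v z)"
proof -
  have sm: "smooth_on ({a<..<b} \<times> S2) v" using v(1) by (simp add: test_function_def)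
  note pd = smooth_on_cylinder_pd_ss[OF sm]
  obtain c d where cd: "a < c" "c \<le> d" "d < b"
    and supp: "\<And>s w. s \<in> {a<..<b} \<Longrightarrow> s \<notin> {c<..<d} \<Longrightarrow> w \<in> S2 \<Longrightarrow>
       v (s, w) = 0 \<and> deriv (\<lambda>t. v (t, w)) s = 0 \<and> pd_ss v (s, w) = 0"
    using test_function_support[OF v(1) ab] by blast
  define K where "K = {c..d} \<times> S2"
  have KM: "K \<subseteq> M" using cd by (auto simp: K_def M_def)
  have cK: "compact K" unfolding K_def by (intro compact_Times compact_Icc compact_sphere)
  define q1 where "q1 z = h (fst z) * pd_ss v z" for z
  define q2 where "q2 z = k (fst z) * v z" for z
  have c1: "continuous_on K q1" unfolding q1_def
    by (intro continuous_on_mult continuous_on_compose2[OF h] continuous_on_fst continuous_on_id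
         continuous_on_subset[OF pd(1)]) (use cd in \<open>auto simp: K_def\<close>)
  have c2: "continuous_on K q2" unfolding q2_def
    by (intro continuous_on_mult continuous_on_compose2[OF k] continuous_on_fst continuous_on_id
         continuous_on_subset[OF smooth_on_continuous[OF sm]]) (use cd in \<open>auto simp: K_def\<close>)
  have "indicator M z *\<^sub>R q1 z = indicator K z *\<^sub>R q1 z \<and> indicator M z *\<^sub>R q2 z = indicator K z *\<^sub>R q2 z" for z
  proof (cases "z \<in> M - K")
    case True
    obtain s w where z: "z = (s, w)" by (cases z)
    with True have "s \<in> {a<..<b}" "w \<in> S2" "s \<notin> {c<..<d}" unfolding M_def K_def by auto
    then show ?thesis using supp[of s w] z by (simp add: q1_def q2_def)
  qed (use KM in \<open>auto simp: indicator_def\<close>)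
  then have e: "(\<lambda>z. indicator M z *\<^sub>R q1 z) = (\<lambda>z. indicator K z *\<^sub>R q1 z)" "(\<lambda>z. indicator M z *\<^sub>R q2 z) = (\<lambda>z. indicator K z *\<^sub>R q2 z)"
    by auto
  have i: "integrable N (\<lambda>z. indicator K z *\<^sub>R q1 z)" "integrable N (\<lambda>z. indicator K z *\<^sub>R q2 z)"
    unfolding N_def by (rule integrable_compact_lborel_sphere_vol[OF cK c1], rule integrable_compact_lborel_sphere_vol[OF cK c2])
  then show "set_integrable N M (\<lambda>z. h (fst z) * pd_ss v z)" "set_integrable N M (\<lambda>z. k (fst z) * v z)"
    unfolding set_integrable_def q1_def[symmetric] q2_def[symmetric] e .
  interpret sv: finite_measure sphere_vol by (rule finite_measure_sphere_vol)
  interpret P: pair_sigma_finite lborel sphere_vol ..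
  define G where "G s w = indicator K (s, w) *\<^sub>R (q1 (s, w) - q2 (s, w))" for s w
  have G: "case_prod G = (\<lambda>z. indicator K z *\<^sub>R q1 z - indicator K z *\<^sub>R q2 z)"
    by (auto simp: G_def fun_eq_iff algebra_simps)
  have iG: "integrable N (case_prod G)" unfolding G using i by (rule Bochner_Integration.integrable_diff)
  have inner: "(LINT s|lborel. G s w) \<le> 0" for w
  proof (cases "w \<in> S2")
    case True
    have "integral {c..d} (\<lambda>s. h s * pd_ss v (s, w) - k s * v (s, w)) \<le> 0"
    proof (rule meridian[OF cd])
      show "((\<lambda>s. v (s, w)) has_real_derivative deriv (\<lambda>t. v (t, w)) s) (at s)" if "s \<in> {c..d}" for s
        using pd(2)[of s w] that cd True by auto
      show "(deriv (\<lambda>t. v (t, w)) has_real_derivative pd_ss v (s, w)) (at s)" if "s \<in> {c..d}" for s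
        using pd(3)[of s w] that cd True by auto
      show "continuous_on {c..d} (\<lambda>s. pd_ss v (s, w))"
        by (rule continuous_on_compose2[OF pd(1)]) (use cd True in \<open>auto intro!: continuous_intros\<close>)
      show "v (s, w) \<ge> 0" if "s \<in> {c..d}" for s using v(2)[of "(s, w)"] that cd True by auto
    qed (use supp[of c w] supp[of d w] cd True in auto)
    moreover have "(LINT s|lborel. G s w) = (LINT s:{c..d}|lborel. h s * pd_ss v (s, w) - k s * v (s, w))"
      unfolding set_lebesgue_integral_def G_def K_def q1_def q2_def
      using True by (intro Bochner_Integration.integral_cong) (auto simp: indicator_def)
    moreover have "set_integrable lborel {c..d} (\<lambda>s. h s * pd_ss v (s, w) - k s * v (s, w))"
      unfolding set_integrable_def
    proof (rule borel_integrable_compact[OF compact_Icc])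
      have "continuous_on {c..d} (\<lambda>s. q1 (s, w) - q2 (s, w))"
        by (intro continuous_on_diff continuous_on_compose2[OF c1] continuous_on_compose2[OF c2])
          (use True in \<open>auto simp: K_def intro!: continuous_intros\<close>)
      then show "continuous_on {c..d} (\<lambda>s. h s * pd_ss v (s, w) - k s * v (s, w))" by (simp add: q1_def q2_def)
    qed
    ultimately show ?thesis by (simp add: set_borel_integral_eq_integral(2))
  next
    case False
    then have "G s w = 0" for s by (simp add: G_def K_def)
    then show ?thesis by simp
  qed
  have "(LINT z|N. case_prod G z) = (LINT w|sphere_vol. LINT s|lborel. G s w)"
    using P.integral_snd[of G] iG unfolding N_def by simp
  also have "\<dots> \<le> 0"
  proof -
    have "0 \<le> (LINT w|sphere_vol. - (LINT s|lborel. G s w))"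
      by (rule Bochner_Integration.integral_nonneg) (use inner in auto)
    then show ?thesis by simp
  qed
  finally have "(LINT z|N. indicator K z *\<^sub>R q1 z) - (LINT z|N. indicator K z *\<^sub>R q2 z) \<le> 0"
    unfolding G Bochner_Integration.integral_diff[OF i] .
  then show "(LINT z:M|N. h (fst z) * pd_ss v z) \<le> (LINT z:M|N. k (fst z) * v z)"
    unfolding set_lebesgue_integral_def q1_def[symmetric] q2_def[symmetric] e by simp
qed

section \<open>The limit metric\<close>

theorem theorem4p9:
  fixes D A :: real
    and L :: "nat \<Rightarrow> real"
    and f :: "nat \<Rightarrow> real \<Rightarrow> real"
    and g :: "nat \<Rightarrow> (real \<times> (real^3)) metric"
    and r :: "nat \<Rightarrow> nat"
    and f_lim :: "real \<Rightarrow> real"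
  assumes "D > 0" and "A > 0"
    and "\<And>j. rot_symmetric_sphere (L j) (f j) (g j)"
    and "\<And>j. riem_diam S3 (g j) \<le> ennreal D"
    and "\<And>j. nonneg_scalar3 S3 (g j)"
    and "\<And>j. MinA S3 (g j) \<ge> ennreal A"
    and "strict_mono r"
    and "uniform_limit {0..D} (\<lambda>j. extend_zero (L (r j)) (f (r j))) f_lim sequentially"
  shows "nonneg_generalized_scalar (interior_limit D f_lim) (\<lambda>s. f_lim s powr (3/2))"
proof (cases "a_end D f_lim < b_end D f_lim")
  case False
  then have "interior_limit D f_lim = {}" by (auto simp: interior_limit_def)
  then show ?thesis by (simp add: nonneg_generalized_scalar_def set_integrable_def set_lebesgue_integral_def)
next
  case ab: True
  let ?a = "a_end D f_lim" and ?b = "b_end D f_lim"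
  note g = assms(3) and lim = assms(8)
  obtain \<epsilon> :: real where \<epsilon>: "\<epsilon> > 0"
    "\<And>L f g s. rot_symmetric_sphere L f g \<Longrightarrow> MinA S3 g \<ge> ennreal A \<Longrightarrow> s \<in> {0<..<L} \<Longrightarrow> deriv f s = 0 \<Longrightarrow> f s \<ge> \<epsilon>"
    using neck_radius_bound[OF assms(2)] by blast
  have LD: "L j \<le> D" for j
  proof -
    have "ennreal (L j) \<le> ennreal D" by (rule order_trans[OF diameter_ge_pole_distance[OF g] assms(4)])
    then show ?thesis using assms(1) by (simp add: ennreal_le_iff)
  qed
  have neck: "f (r j) s \<ge> \<epsilon>" if "s \<in> {0<..<L (r j)}" "deriv (f (r j)) s = 0" for j s
    by (rule \<epsilon>(2)[OF g assms(6) that])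
  have int: "s \<in> {0<..<D}" "f_lim s > 0" if "s \<in> {?a<..<?b}" for s
    by (rule limit_interior[of "\<lambda>j. L (r j)" "\<lambda>j. f (r j)" "\<lambda>j. g (r j)" D \<epsilon> f_lim,
          OF g LD assms(1) _ \<epsilon>(1) lim that], rule neck, assumption+)+
  note weak = weak_inequality_limit[of "\<lambda>j. L (r j)" "\<lambda>j. f (r j)" "\<lambda>j. g (r j)" D f_lim, OF g assms(5) lim]
  have cont: "continuous_on {?a<..<?b} f_lim"
  proof -
    have "continuous_on {0..D} f_lim"
      by (rule uniform_limit_theorem[OF _ lim])
        (auto intro!: always_eventually continuous_on_subset[OF extend_zero_properties(1)[OF g]])
    then show ?thesis by (rule continuous_on_subset) (use int(1) in fastforce)
  qed
  have ne: "\<forall>s\<in>{?a<..<?b}. f_lim s \<noteq> 0" using int(2) by fastforce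
  have ch: "continuous_on {?a<..<?b} (\<lambda>s. f_lim s powr (3/2))" "continuous_on {?a<..<?b} (\<lambda>s. 3/4 * f_lim s powr (-1/2))"
    by (intro continuous_intros cont ne)+
  have pp: "(f_lim s powr (3/2)) powr (-1/3) = f_lim s powr (-1/2)" for s
    by (simp add: powr_powr)
  have *: "set_integrable (lborel \<Otimes>\<^sub>M sphere_vol) ({?a<..<?b} \<times> S2) (\<lambda>z. f_lim (fst z) powr (3/2) * pd_ss v z)"
    "set_integrable (lborel \<Otimes>\<^sub>M sphere_vol) ({?a<..<?b} \<times> S2) (\<lambda>z. 3/4 * f_lim (fst z) powr (-1/2) * v z)"
    "(LINT z:{?a<..<?b} \<times> S2|(lborel \<Otimes>\<^sub>M sphere_vol). f_lim (fst z) powr (3/2) * pd_ss v z)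
       \<le> (LINT z:{?a<..<?b} \<times> S2|(lborel \<Otimes>\<^sub>M sphere_vol). 3/4 * f_lim (fst z) powr (-1/2) * v z)"
    if v: "test_function ({?a<..<?b} \<times> S2) v" "\<And>z. z \<in> {?a<..<?b} \<times> S2 \<Longrightarrow> v z \<ge> 0" for v
  proof -
    have m: "integral {c..d} (\<lambda>s. f_lim s powr (3/2) * \<phi>'' s - 3/4 * f_lim s powr (-1/2) * \<phi> s) \<le> 0"
      if cd: "?a < c" "c \<le> d" "d < ?b"
        and \<phi>: "\<And>s. s \<in> {c..d} \<Longrightarrow> (\<phi> has_real_derivative \<phi>' s) (at s)"
          "\<And>s. s \<in> {c..d} \<Longrightarrow> (\<phi>' has_real_derivative \<phi>'' s) (at s)" "continuous_on {c..d} \<phi>''"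
          "\<And>s. s \<in> {c..d} \<Longrightarrow> \<phi> s \<ge> 0" "\<phi> c = 0" "\<phi>' c = 0" "\<phi> d = 0" "\<phi>' d = 0"
      for c d \<phi> \<phi>' \<phi>''
    proof (rule weak[OF cd(2) _ _ \<phi>])
      have sub: "s \<in> {?a<..<?b}" if "s \<in> {c..d}" for s using cd that by auto
      show "{c..d} \<subseteq> {0..D}" using int(1)[OF sub] by fastforce
      show "f_lim s > 0" if "s \<in> {c..d}" for s by (rule int(2)[OF sub[OF that]])
    qed
    show "set_integrable (lborel \<Otimes>\<^sub>M sphere_vol) ({?a<..<?b} \<times> S2) (\<lambda>z. f_lim (fst z) powr (3/2) * pd_ss v z)"
      by (rule distributional_inequality_from_meridians(1)[OF ab ch v], assumption) (fact m)
    show "set_integrable (lborel \<Otimes>\<^sub>M sphere_vol) ({?a<..<?b} \<times> S2) (\<lambda>z. 3/4 * f_lim (fst z) powr (-1/2) * v z)"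
      by (rule distributional_inequality_from_meridians(2)[OF ab ch v], assumption) (fact m)
    show "(LINT z:{?a<..<?b} \<times> S2|(lborel \<Otimes>\<^sub>M sphere_vol). f_lim (fst z) powr (3/2) * pd_ss v z)
       \<le> (LINT z:{?a<..<?b} \<times> S2|(lborel \<Otimes>\<^sub>M sphere_vol). 3/4 * f_lim (fst z) powr (-1/2) * v z)"
      by (rule distributional_inequality_from_meridians(3)[OF ab ch v], assumption) (fact m)
  qed
  show ?thesis
    unfolding nonneg_generalized_scalar_def interior_limit_def pp
  proof (intro allI impI)
    fix v assume v: "test_function ({?a<..<?b} \<times> S2) v \<and> (\<forall>z\<in>{?a<..<?b} \<times> S2. 0 \<le> v z)"
    show "set_integrable (lborel \<Otimes>\<^sub>M sphere_vol) ({?a<..<?b} \<times> S2) (\<lambda>z. f_lim (fst z) powr (3/2) * pd_ss v z) \<and>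
      set_integrable (lborel \<Otimes>\<^sub>M sphere_vol) ({?a<..<?b} \<times> S2) (\<lambda>z. 3/4 * f_lim (fst z) powr (-1/2) * v z) \<and>
      (LINT z:{?a<..<?b} \<times> S2|(lborel \<Otimes>\<^sub>M sphere_vol). f_lim (fst z) powr (3/2) * pd_ss v z)
       \<le> (LINT z:{?a<..<?b} \<times> S2|(lborel \<Otimes>\<^sub>M sphere_vol). 3/4 * f_lim (fst z) powr (-1/2) * v z)"
      using *[OF conjunct1[OF v] bspec[OF conjunct2[OF v]]] by (intro conjI)
  qed
qed

end
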